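(* There exists a universal constant $c < 1/\sqrt{2\pi} \approx 0.398$ such that for every bounded convex domain $\Omega \subset \mathbb{R}^2$, the solution $u$ of $-\Delta u = 1$ in $\Omega$ with $u = 0$ on $\partial\Omega$ satisfies $$ \|\nabla u\|_{L^{\infty}(\Omega)} \leq c \cdot |\Omega|^{1/2}.$$ Moreover, the constant $c$ in this inequality cannot be replaced by $0.357$ (i.e. the optimal constant is at least $0.357$).
   Context: $|\Omega|$ denotes the area (Lebesgue measure) of $\Omega$. *)

theory Defs
  imports "HOL-Analysis.Analysis"
begin

definition bounded_convex_domain :: "(real^2) set \<Rightarrow> bool" where
  "bounded_convex_domain \<Omega> \<longleftrightarrow> \<Omega> \<noteq> {} \<and> open \<Omega> \<and> convex \<Omega> \<and> bounded \<Omega>"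

definition grad :: "(real^2 \<Rightarrow> real) \<Rightarrow> real^2 \<Rightarrow> real^2" where
  "grad u x = (\<chi> i. frechet_derivative u (at x) (axis i 1))"

definition second_partial :: "(real^2 \<Rightarrow> real) \<Rightarrow> 2 \<Rightarrow> 2 \<Rightarrow> real^2 \<Rightarrow> real" where
  "second_partial u i j x = frechet_derivative (\<lambda>y. grad u y $ i) (at x) (axis j 1)"

definition laplacian :: "(real^2 \<Rightarrow> real) \<Rightarrow> real^2 \<Rightarrow> real" where
  "laplacian u x = (\<Sum>i\<in>UNIV. second_partial u i i x)"

definition C2_on :: "(real^2) set \<Rightarrow> (real^2 \<Rightarrow> real) \<Rightarrow> bool" where
  "C2_on \<Omega> u \<longleftrightarrow>
     (\<forall>x\<in>\<Omega>. u differentiable (at x)) \<and>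
     (\<forall>x\<in>\<Omega>. \<forall>i. (\<lambda>y. grad u y $ i) differentiable (at x)) \<and>
     (\<forall>i j. continuous_on \<Omega> (second_partial u i j))"

definition torsion_function :: "(real^2) set \<Rightarrow> (real^2 \<Rightarrow> real) \<Rightarrow> bool" where
  "torsion_function \<Omega> u \<longleftrightarrow>
     C2_on \<Omega> u \<and> continuous_on (closure \<Omega>) u \<and>
     (\<forall>x\<in>\<Omega>. - laplacian u x = 1) \<and>
     (\<forall>x\<in>frontier \<Omega>. u x = 0)"

end

theory Submission
  imports Defs "HOL-Complex_Analysis.Complex_Analysis" "HOL-Real_Asymp.Real_Asymp"
begin

text \<open>Upper bound. If \<open>\<Omega>\<close> lies in a half plane, comparison with a quadratic barrier in a strip of
  width \<open>t\<close> along the boundary line reduces the estimate \<open>u \<le> L * depth\<close> to a bound for \<open>u\<close> at points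
  of depth exactly \<open>t\<close>; the maximum principle for \<open>u (x + h) - u x\<close> then turns it into \<open>|grad u| \<le> L\<close>.
  At a point \<open>p\<close> a Riemann map \<open>F w = p + a\<^sub>1 w + a\<^sub>2 w\<^sup>2 + \<dots>\<close> of the disc onto \<open>\<Omega>\<close> gives
  \<open>u p = (\<Sum>n. |a\<^sub>n|\<^sup>2) / 4\<close> and area \<open>\<pi> (\<Sum>n. n |a\<^sub>n|\<^sup>2)\<close>, hence \<open>u p \<le> (|a\<^sub>1|\<^sup>2 + area / \<pi>) / 8\<close>.
  With \<open>area = 8 \<pi> t\<^sup>2\<close> the half plane bound \<open>|a\<^sub>1| \<le> 2 t\<close> would give exactly the classical constant
  \<open>1 / sqrt (2 \<pi>)\<close>. But for maps into a half plane \<open>|a\<^sub>2| \<ge> 4 |a\<^sub>1| - 6 t\<close>, so \<open>|a\<^sub>1|\<close> near \<open>2 t\<close> forces too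
  much area; this yields \<open>|a\<^sub>1| \<le> 1.9 t\<close> and a strictly smaller constant.

  Lower bound. On \<open>\<Omega> = f (disc)\<close> with \<open>f\<close> a polynomial, \<open>u (f w) = (Re (Q w) - |f w|\<^sup>2) / 4\<close>, where
  \<open>Q\<close> is the polynomial with \<open>Re Q = |f|\<^sup>2\<close> on the unit circle. Area and boundary gradient at \<open>f 1\<close> are
  explicit in the coefficients, and a numerically optimised \<open>f\<close> of degree 17 does the job.\<close>

text \<open>With \<open>|a1| <= 2 t\<close> at depth \<open>t\<close>, the barrier slope
  \<open>u / t + t / 2\<close> is at most \<open>t + area / (8 pi t)\<close>. This is smallest for
  \<open>area = 8 pi t^2\<close>, where it equals \<open>2 t\<close>; hence the choice of
  \<open>t\<close>. Replacing 2 by 1.9 turns the slope into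
  \<open>(11.61 / 8 + 1 / 2) t = 1.95125 t\<close>, and \<open>1.95125 / 2 = 0.975625\<close> is the
  factor gained over the classical constant. The obstacle is the boundary: \<open>u\<close> is
  merely continuous there and corners are allowed, so difference quotients in the interior take the
  place of boundary gradients. Likewise the Riemann map is used on discs of radius
  \<open>r < 1\<close>, with \<open>r\<close> so close to 1 that \<open>u\<close> is already small
  on the image of the circle \<open>|w| = r\<close>. For the lower bound \<open>f\<close> is a
  polynomial that is injective up to the circle, so boundary data are explicit. Injectivity and
  convexity of the image both follow from strict positivity of a trigonometric polynomial with
  integer coefficients, and this is certified by exact evaluation.\<close>

unbundle no fps_syntax

section \<open>The weak maximum principle\<close>

text \<open>A relation along a single line rather than a derivative operator: sums, multiples and
  translates combine directly, and the first derivative \<open>p\<close> is only required near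
  \<open>s = 0\<close>.\<close>

definition second_dir_deriv :: "(real^2 \<Rightarrow> real) \<Rightarrow> real^2 \<Rightarrow> real^2 \<Rightarrow> real \<Rightarrow> bool" where
  "second_dir_deriv v x e d \<longleftrightarrow>
     (\<exists>p. (\<forall>\<^sub>F s in nhds 0. ((\<lambda>s. v (x + s *\<^sub>R e)) has_real_derivative p s) (at s)) \<and>
          (p has_real_derivative d) (at 0))"

lemma second_dir_derivI:
  assumes "\<forall>\<^sub>F s in nhds 0. ((\<lambda>s. v (x + s *\<^sub>R e)) has_real_derivative p s) (at s)"
    and "(p has_real_derivative d) (at 0)"
  shows "second_dir_deriv v x e d"
  unfolding second_dir_deriv_def using assms by (intro exI[of _ p] conjI)

lemma second_dir_deriv_add:
  assumes "second_dir_deriv v x e d" "second_dir_deriv w x e d'"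
  shows "second_dir_deriv (\<lambda>y. v y + w y) x e (d + d')"
proof -
  obtain p q where p: "\<forall>\<^sub>F s in nhds 0. ((\<lambda>s. v (x + s *\<^sub>R e)) has_real_derivative p s) (at s)"
      "(p has_real_derivative d) (at 0)"
    and q: "\<forall>\<^sub>F s in nhds 0. ((\<lambda>s. w (x + s *\<^sub>R e)) has_real_derivative q s) (at s)"
      "(q has_real_derivative d') (at 0)"
    using assms unfolding second_dir_deriv_def by blast
  have "\<forall>\<^sub>F s in nhds 0. ((\<lambda>s. v (x + s *\<^sub>R e) + w (x + s *\<^sub>R e)) has_real_derivative p s + q s) (at s)"
    using p(1) q(1) by eventually_elim (rule DERIV_add)
  then show ?thesis
    by (rule second_dir_derivI) (rule DERIV_add[OF p(2) q(2)])
qed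

lemma second_dir_deriv_cmult:
  assumes "second_dir_deriv v x e d"
  shows "second_dir_deriv (\<lambda>y. c * v y) x e (c * d)"
proof -
  obtain p where p: "\<forall>\<^sub>F s in nhds 0. ((\<lambda>s. v (x + s *\<^sub>R e)) has_real_derivative p s) (at s)"
      "(p has_real_derivative d) (at 0)"
    using assms unfolding second_dir_deriv_def by blast
  have "\<forall>\<^sub>F s in nhds 0. ((\<lambda>s. c * v (x + s *\<^sub>R e)) has_real_derivative c * p s) (at s)"
    using p(1) by eventually_elim (rule DERIV_cmult)
  then show ?thesis
    by (rule second_dir_derivI) (rule DERIV_cmult[OF p(2)])
qed

lemma second_dir_deriv_translate:
  assumes "second_dir_deriv v (x + h) e d"
  shows "second_dir_deriv (\<lambda>y. v (y + h)) x e d"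
  using assms unfolding second_dir_deriv_def by (simp add: add.assoc add.commute[of _ h] add.left_commute[of h])

lemma second_dir_deriv_quadratic:
  assumes "\<And>s. v (x + s *\<^sub>R e) = a + b * s + c * s\<^sup>2"
  shows "second_dir_deriv v x e (2 * c)"
proof (rule second_dir_derivI)
  show "\<forall>\<^sub>F s in nhds 0. ((\<lambda>s. v (x + s *\<^sub>R e)) has_real_derivative b + 2 * c * s) (at s)"
    unfolding assms by (intro always_eventually allI) (auto intro!: derivative_eq_intros)
  show "((\<lambda>s. b + 2 * c * s) has_real_derivative 2 * c) (at 0)"
    by (auto intro!: derivative_eq_intros)
qed

lemma second_dir_deriv_inner:
  "second_dir_deriv (\<lambda>y. a \<bullet> y + c) x e 0"
  using second_dir_deriv_quadratic[of "\<lambda>y. a \<bullet> y + c" x e "a \<bullet> x + c" "a \<bullet> e" 0]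
  by (simp add: inner_add_right algebra_simps)

lemma second_dir_deriv_inner_square:
  "second_dir_deriv (\<lambda>y. (a \<bullet> y + c)\<^sup>2) x e (2 * (a \<bullet> e)\<^sup>2)"
  by (rule second_dir_deriv_quadratic[where a = "(a \<bullet> x + c)\<^sup>2" and b = "2 * (a \<bullet> x + c) * (a \<bullet> e)"])
     (simp add: inner_add_right power2_eq_square algebra_simps)

lemma norm_add_squared_scaleR:
  fixes a e :: "'a::real_inner"
  shows "(norm (a + s *\<^sub>R e))\<^sup>2 = (norm a)\<^sup>2 + (2 * (a \<bullet> e)) * s + (norm e)\<^sup>2 * s\<^sup>2"
  unfolding power2_norm_eq_inner power2_eq_square[of s] inner_add_left inner_add_right
    inner_scaleR_left inner_scaleR_right inner_commute[of e a]
  by algebra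

lemma second_dir_deriv_dist_square:
  "second_dir_deriv (\<lambda>y. (norm (y - c))\<^sup>2) x e (2 * (norm e)\<^sup>2)"
proof (rule second_dir_deriv_quadratic)
  fix s
  have "x + s *\<^sub>R e - c = (x - c) + s *\<^sub>R e" by simp
  then show "(norm (x + s *\<^sub>R e - c))\<^sup>2 = (norm (x - c))\<^sup>2 + (2 * ((x - c) \<bullet> e)) * s + (norm e)\<^sup>2 * s\<^sup>2"
    by (simp only: norm_add_squared_scaleR)
qed

text \<open>If \<open>d > 0\<close>, the first derivative vanishes at the maximum and turns positive
  just to its right, so \<open>v\<close> would increase strictly there.\<close>

lemma second_dir_deriv_local_max:
  assumes "second_dir_deriv v x e d" and "\<forall>\<^sub>F s in nhds 0. v (x + s *\<^sub>R e) \<le> v x"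
  shows "d \<le> 0"
proof (rule ccontr)
  assume "\<not> d \<le> 0"
  obtain p where p: "\<forall>\<^sub>F s in nhds 0. ((\<lambda>s. v (x + s *\<^sub>R e)) has_real_derivative p s) (at s)"
      "(p has_real_derivative d) (at 0)"
    using assms unfolding second_dir_deriv_def by blast
  obtain r where r: "r > 0" and rd: "\<And>s. \<bar>s\<bar> < r \<Longrightarrow> ((\<lambda>s. v (x + s *\<^sub>R e)) has_real_derivative p s) (at s)"
    and rm: "\<And>s. \<bar>s\<bar> < r \<Longrightarrow> v (x + s *\<^sub>R e) \<le> v x"
    using eventually_conj[OF p(1) assms(2)] unfolding eventually_nhds_metric dist_real_def by auto
  have "p 0 = 0"
    by (rule DERIV_local_max[OF rd r]) (use r rm in auto)
  moreover obtain r' where r': "r' > 0" "\<And>h. h > 0 \<Longrightarrow> h < r' \<Longrightarrow> p 0 < p (0 + h)"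
    using DERIV_pos_inc_right[OF p(2)] \<open>\<not> d \<le> 0\<close> by (metis linorder_not_le)
  ultimately have pos: "p h > 0" if "0 < h" "h < r'" for h
    using that by simp
  define h where "h = min r r' / 2"
  have h: "0 < h" "h < r" "h < r'" using r r' by (auto simp: h_def)
  have "v (x + 0 *\<^sub>R e) < v (x + h *\<^sub>R e)"
  proof (rule DERIV_pos_imp_increasing_open[of 0 h "\<lambda>s. v (x + s *\<^sub>R e)"])
    show "\<exists>y. DERIV (\<lambda>s. v (x + s *\<^sub>R e)) s :> y \<and> 0 < y" if "0 < s" "s < h" for s
      using rd[of s] pos[of s] that h by (intro exI[of _ "p s"] conjI) auto
    show "continuous_on {0..h} (\<lambda>s. v (x + s *\<^sub>R e))"
    proof (rule DERIV_atLeastAtMost_imp_continuous_on)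
      show "\<exists>y. DERIV (\<lambda>s. v (x + s *\<^sub>R e)) s :> y" if "0 \<le> s" "s \<le> h" for s
        using rd[of s] that h by (intro exI[of _ "p s"]) auto
    qed
  qed (use h in auto)
  then show False using rm[of h] h by simp
qed

definition subharmonic_at :: "(real^2 \<Rightarrow> real) \<Rightarrow> real^2 \<Rightarrow> bool" where
  "subharmonic_at v x \<longleftrightarrow>
     (\<exists>d1 d2. second_dir_deriv v x (axis 1 1) d1 \<and> second_dir_deriv v x (axis 2 1) d2 \<and> d1 + d2 \<ge> 0)"

text \<open>Adding a small multiple of \<open>|y - x0|^2\<close> makes the Laplacian strictly
  positive, which excludes an interior maximum.\<close>

theorem weak_maximum_principle:
  assumes V: "open V" "bounded V" and cont: "continuous_on (closure V) v"
    and sub: "\<And>x. x \<in> V \<Longrightarrow> subharmonic_at v x"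
    and bd: "\<And>x. x \<in> frontier V \<Longrightarrow> v x \<le> B" and x0: "x0 \<in> V"
  shows "v x0 \<le> B"
proof (rule ccontr)
  assume neg: "\<not> v x0 \<le> B"
  obtain R where R: "R > 0" "\<And>x. x \<in> closure V \<Longrightarrow> norm (x - x0) \<le> R"
  proof -
    have "bounded ((\<lambda>x. x - x0) ` closure V)"
      using V(2) bounded_closure bounded_translation_minus by blast
    then show ?thesis using that unfolding bounded_pos by auto
  qed
  \<comment> \<open>On the closure the perturbation is at most \<open>\<epsilon> * R^2\<close>, half
    the assumed excess of \<open>v x0\<close> over \<open>B\<close>, and it vanishes at
    \<open>x0\<close>; a maximum of \<open>w\<close> on the frontier is therefore
    impossible.\<close>
  define \<epsilon> where "\<epsilon> = (v x0 - B) / (2 * R\<^sup>2)"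
  have \<epsilon>: "\<epsilon> > 0" "\<epsilon> * R\<^sup>2 < v x0 - B" using neg R by (auto simp: \<epsilon>_def)
  define w where "w y = v y + \<epsilon> * (norm (y - x0))\<^sup>2" for y
  have cw: "continuous_on (closure V) w"
    unfolding w_def by (intro continuous_intros cont)
  have comp: "compact (closure V)" using V by (simp add: compact_closure)
  have "x0 \<in> closure V" using x0 closure_subset[of V] by auto
  then have ne: "closure V \<noteq> {}" by auto
  obtain y where y: "y \<in> closure V" "\<And>z. z \<in> closure V \<Longrightarrow> w z \<le> w y"
    using continuous_attains_sup[OF comp ne cw] by auto
  have "w x0 = v x0" by (simp add: w_def)
  have "y \<in> V"
  proof (rule ccontr)
    assume "y \<notin> V"
    then have "y \<in> frontier V" using y V by (simp add: frontier_def interior_open)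
    then have "v y \<le> B" by (rule bd)
    moreover have "\<epsilon> * (norm (y - x0))\<^sup>2 \<le> \<epsilon> * R\<^sup>2"
      by (rule mult_left_mono[OF power_mono[OF R(2)[OF y(1)]]]) (use \<epsilon> in auto)
    ultimately have "w y \<le> B + \<epsilon> * R\<^sup>2"
      unfolding w_def by linarith
    then show False using y(2)[OF \<open>x0 \<in> closure V\<close>] \<epsilon> \<open>w x0 = v x0\<close> by linarith
  qed
  then obtain d1 d2 where d: "second_dir_deriv v y (axis 1 1) d1" "second_dir_deriv v y (axis 2 1) d2" "d1 + d2 \<ge> 0"
    using sub unfolding subharmonic_at_def by blast
  have ev: "\<forall>\<^sub>F s in nhds 0. w (y + s *\<^sub>R e) \<le> w y" for e
  proof -
    have "((\<lambda>s. y + s *\<^sub>R e) \<longlongrightarrow> y + 0 *\<^sub>R e) (nhds 0)"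
      by (intro tendsto_intros filterlim_ident)
    then have "\<forall>\<^sub>F s in nhds 0. y + s *\<^sub>R e \<in> V"
      using topological_tendstoD[of _ "y + 0 *\<^sub>R e" _ V] V(1) \<open>y \<in> V\<close> by simp
    then show ?thesis
      by eventually_elim (rule y(2), use closure_subset[of V] in blast)
  qed
  have "d + \<epsilon> * 2 \<le> 0" if "second_dir_deriv v y e d" "norm e = 1" for e d
  proof (rule second_dir_deriv_local_max[OF _ ev])
    show "second_dir_deriv w y e (d + \<epsilon> * 2)"
      using second_dir_deriv_add[OF that(1) second_dir_deriv_cmult[OF second_dir_deriv_dist_square[of x0 y e], of \<epsilon>]]
      unfolding w_def by (simp add: that(2))
  qed
  note le = this
  have "d1 + \<epsilon> * 2 \<le> 0" "d2 + \<epsilon> * 2 \<le> 0"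
    by (rule le[OF d(1)], simp add: norm_axis_1) (rule le[OF d(2)], simp add: norm_axis_1)
  then show False using d(3) \<epsilon>(1) by linarith
qed

section \<open>Second derivatives of torsion functions along the axes\<close>

lemma torsion_function_second_dir_deriv:
  assumes t: "torsion_function \<Omega> u" and "open \<Omega>" and x: "x \<in> \<Omega>"
  shows "second_dir_deriv u x (axis i 1) (second_partial u i i x)"
proof -
  have d1: "\<And>y. y \<in> \<Omega> \<Longrightarrow> u differentiable (at y)"
    and d2: "\<And>y. y \<in> \<Omega> \<Longrightarrow> (\<lambda>y. grad u y $ i) differentiable (at y)"
    using t unfolding torsion_function_def C2_on_def by auto
  have line: "((\<lambda>s. x + s *\<^sub>R axis i 1) has_derivative (\<lambda>s. s *\<^sub>R axis i 1)) (at s)" for s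
    by (auto intro!: derivative_eq_intros)
  have "((\<lambda>s. x + s *\<^sub>R axis i 1) \<longlongrightarrow> x + 0 *\<^sub>R axis i 1) (nhds 0)"
    by (intro tendsto_intros filterlim_ident)
  then have "\<forall>\<^sub>F s in nhds 0. x + s *\<^sub>R axis i 1 \<in> \<Omega>"
    using \<open>open \<Omega>\<close> x by (intro topological_tendstoD[of _ x]) auto
  then have "\<forall>\<^sub>F s in nhds 0. ((\<lambda>s. u (x + s *\<^sub>R axis i 1)) has_real_derivative
      grad u (x + s *\<^sub>R axis i 1) $ i) (at s)"
  proof eventually_elim
    case (elim s)
    let ?D = "frechet_derivative u (at (x + s *\<^sub>R axis i 1))"
    have D: "(u has_derivative ?D) (at (x + s *\<^sub>R axis i 1))"
      using d1[OF elim] by (simp add: frechet_derivative_works)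
    then have lin: "linear ?D" using has_derivative_linear by blast
    have "((\<lambda>s. u (x + s *\<^sub>R axis i 1)) has_derivative (\<lambda>s. ?D (s *\<^sub>R axis i 1))) (at s)"
      using has_derivative_compose[OF line D] .
    then show ?case
      unfolding has_field_derivative_def grad_def
      by (elim has_derivative_eq_rhs) (use lin in \<open>simp add: linear_cmul fun_eq_iff mult.commute\<close>)
  qed
  moreover have "((\<lambda>s. grad u (x + s *\<^sub>R axis i 1) $ i) has_real_derivative second_partial u i i x) (at 0)"
  proof -
    let ?D = "frechet_derivative (\<lambda>y. grad u y $ i) (at (x + 0 *\<^sub>R axis i 1))"
    have D: "((\<lambda>y. grad u y $ i) has_derivative ?D) (at (x + 0 *\<^sub>R axis i 1))"
      using d2[OF x] by (simp add: frechet_derivative_works)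
    then have lin: "linear ?D" using has_derivative_linear by blast
    have "((\<lambda>s. grad u (x + s *\<^sub>R axis i 1) $ i) has_derivative (\<lambda>s. ?D (s *\<^sub>R axis i 1))) (at 0)"
      using has_derivative_compose[OF line D] .
    then show ?thesis
      unfolding has_field_derivative_def second_partial_def
      by (elim has_derivative_eq_rhs) (use lin in \<open>simp add: linear_cmul fun_eq_iff mult.commute\<close>)
  qed
  ultimately show ?thesis
    by (rule second_dir_derivI)
qed

lemma torsion_function_laplacian:
  assumes "torsion_function \<Omega> u" "x \<in> \<Omega>"
  shows "second_partial u 1 1 x + second_partial u 2 2 x = -1"
proof -
  have "- laplacian u x = 1" using assms unfolding torsion_function_def by blast
  then show ?thesis unfolding laplacian_def UNIV_2 by simp
qed

section \<open>The plane as the complex plane\<close>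

definition cx :: "real^2 \<Rightarrow> complex" where "cx x = Complex (x $ 1) (x $ 2)"

definition rv :: "complex \<Rightarrow> real^2" where "rv z = (\<chi> i. if i = 1 then Re z else Im z)"

lemma rv_nth [simp]: "rv z $ 1 = Re z" "rv z $ 2 = Im z"
  by (simp_all add: rv_def)

lemma Re_cx [simp]: "Re (cx x) = x $ 1" and Im_cx [simp]: "Im (cx x) = x $ 2"
  by (simp_all add: cx_def)

lemma cx_rv [simp]: "cx (rv z) = z"
  by (simp add: complex_eq_iff)

lemma rv_cx [simp]: "rv (cx x) = x"
  by (simp add: vec_eq_iff forall_2)

lemma norm_cx [simp]: "norm (cx x) = norm x"
  by (simp add: cmod_def norm_vec_def L2_set_def sum_2)

lemma norm_rv [simp]: "norm (rv z) = norm z"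
  by (metis cx_rv norm_cx)

lemma linear_cx: "linear cx" and linear_rv: "linear rv"
  by (auto intro!: linearI simp: complex_eq_iff vec_eq_iff forall_2)

lemma cx_add: "cx (x + y) = cx x + cx y" and cx_diff: "cx (x - y) = cx x - cx y"
  and cx_scaleR: "cx (s *\<^sub>R x) = s *\<^sub>R cx x"
  by (auto simp: complex_eq_iff vec_eq_iff forall_2)

lemma bounded_linear_cx: "bounded_linear cx" and bounded_linear_rv: "bounded_linear rv"
  using linear_cx linear_rv by (simp_all add: linear_conv_bounded_linear)

lemmas continuous_on_cx [continuous_intros] = bounded_linear.continuous_on[OF bounded_linear_cx]
lemmas continuous_on_rv [continuous_intros] = bounded_linear.continuous_on[OF bounded_linear_rv]

lemma cx_axis [simp]: "cx (axis 1 1) = 1" "cx (axis 2 1) = \<i>"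
  by (simp_all add: complex_eq_iff axis_def)

lemma inner_eq_Re_cx: "x \<bullet> y = Re (cnj (cx x) * cx y)"
  by (simp add: inner_vec_def sum_2)

lemma rv_image_eq_vimage: "rv ` S = cx -` S" and cx_image_eq_vimage: "cx ` T = rv -` T"
  by (auto simp: image_iff) (metis rv_cx, metis cx_rv)

lemma open_rv_image: "open S \<Longrightarrow> open (rv ` S)" and open_cx_image: "open T \<Longrightarrow> open (cx ` T)"
  unfolding rv_image_eq_vimage cx_image_eq_vimage
  by (auto intro!: open_vimage continuous_intros)

lemma cx_has_derivative_line:
  "((\<lambda>s. cx (x + s *\<^sub>R e)) has_vector_derivative cx e) (at s)"
  unfolding cx_add cx_scaleR by (auto intro!: derivative_eq_intros)

text \<open>For the two axes \<open>(cx e)^2\<close> is 1 and -1, so the two values cancel: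
  harmonicity of \<open>Re H\<close> in the form that the maximum principle consumes.\<close>

lemma second_dir_deriv_Re_holomorphic:
  assumes H: "H holomorphic_on S" and S: "open S" and x: "cx x \<in> S"
  shows "second_dir_deriv (\<lambda>y. Re (H (cx y))) x e (Re (deriv (deriv H) (cx x) * (cx e)\<^sup>2))"
proof (rule second_dir_derivI)
  have chain: "((\<lambda>s. Re (h (cx (x + s *\<^sub>R e)) * c)) has_real_derivative Re (deriv h (cx (x + s *\<^sub>R e)) * cx e * c)) (at s)"
    if "h holomorphic_on S" "cx (x + s *\<^sub>R e) \<in> S" for h s c
  proof -
    have "(h has_field_derivative deriv h (cx (x + s *\<^sub>R e))) (at (cx (x + s *\<^sub>R e)))"
      using that S holomorphic_derivI by blast
    then have "((h \<circ> (\<lambda>s. cx (x + s *\<^sub>R e))) has_vector_derivative cx e * deriv h (cx (x + s *\<^sub>R e))) (at s)"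
      using cx_has_derivative_line field_vector_diff_chain_at by blast
    then have "((\<lambda>s. h (cx (x + s *\<^sub>R e)) * c) has_vector_derivative (deriv h (cx (x + s *\<^sub>R e)) * cx e) * c) (at s)"
      using has_vector_derivative_mult_left[of _ _ _ c] by (fastforce simp: o_def mult.commute[of "cx e"])
    then have "((\<lambda>s. Re (h (cx (x + s *\<^sub>R e)) * c)) has_vector_derivative Re (deriv h (cx (x + s *\<^sub>R e)) * cx e * c)) (at s)"
      by (rule bounded_linear.has_vector_derivative[OF bounded_linear_Re])
    then show ?thesis by (simp add: has_real_derivative_iff_has_vector_derivative)
  qed
  have "((\<lambda>s. cx (x + s *\<^sub>R e)) \<longlongrightarrow> cx (x + 0 *\<^sub>R e)) (nhds 0)"
    by (intro bounded_linear.tendsto[OF bounded_linear_cx] tendsto_intros filterlim_ident)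
  then have "\<forall>\<^sub>F s in nhds 0. cx (x + s *\<^sub>R e) \<in> S"
    using topological_tendstoD[of _ "cx (x + 0 *\<^sub>R e)" _ S] S x by simp
  then show "\<forall>\<^sub>F s in nhds 0. ((\<lambda>s. Re (H (cx (x + s *\<^sub>R e)))) has_real_derivative
      Re (deriv H (cx (x + s *\<^sub>R e)) * cx e)) (at s)"
    by eventually_elim (use chain[OF H, of _ 1] in simp)
  have "deriv H holomorphic_on S" using H S by (rule holomorphic_deriv)
  from chain[OF this, of 0 "cx e"] x
  show "((\<lambda>s. Re (deriv H (cx (x + s *\<^sub>R e)) * cx e)) has_real_derivative
      Re (deriv (deriv H) (cx x) * (cx e)\<^sup>2)) (at 0)"
    by (simp add: power2_eq_square mult.assoc)
qed

section \<open>Area of a conformal image\<close>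

text \<open>Identifying \<open>real^2\<close> with pairs of reals maps boxes to boxes of equal
  content, so Fubini for pairs carries over.\<close>

lemma has_integral_rv_iterated:
  fixes f :: "real^2 \<Rightarrow> real"
  assumes cont: "continuous_on (cbox (rv (Complex a c)) (rv (Complex b d))) f"
  shows "(f has_integral integral {a..b} (\<lambda>s. integral {c..d} (\<lambda>t. f (rv (Complex s t)))))
     (cbox (rv (Complex a c)) (rv (Complex b d)))"
proof -
  define g where "g = (\<lambda>x::real^2. (x $ 1, x $ 2))"
  define h where "h = (\<lambda>p. rv (Complex (fst p) (snd p)))"
  have hg: "h (g x) = x" for x by (simp add: g_def h_def vec_eq_iff forall_2)
  have gh: "g (h p) = p" for p by (simp add: g_def h_def)
  have gi: "g ` cbox u v = cbox (g u) (g v)" for u v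
  proof -
    have "g ` cbox u v = h -` cbox u v" by (auto simp: hg gh image_iff) (metis gh)
    also have "\<dots> = cbox (g u) (g v)"
      by (auto simp: g_def h_def mem_box_cart forall_2 cbox_Pair_eq)
    finally show ?thesis .
  qed
  have hi: "h ` cbox p q = cbox (h p) (h q)" for p q
  proof -
    have "h ` cbox p q = h ` g ` cbox (h p) (h q)" by (simp only: gi gh)
    then show ?thesis by (simp add: image_image hg)
  qed
  have ch: "continuous_on X h" for X
    unfolding h_def by (rule linear_continuous_on) (auto intro!: linearI simp: linear_conv_bounded_linear[symmetric] vec_eq_iff forall_2)
  have "continuous_on (cbox (a, c) (b, d)) (f \<circ> h)"
    by (intro continuous_on_compose ch) (use cont hi in \<open>simp add: h_def\<close>)
  then have "((f \<circ> h) has_integral integral {a..b} (\<lambda>s. integral {c..d} (\<lambda>t. (f \<circ> h) (s, t)))) (cbox (a, c) (b, d))"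
    using integral_prod_continuous[of a c b d "f \<circ> h"] integrable_continuous by (metis cbox_interval has_integral_integral)
  then have "((\<lambda>x. (f \<circ> h) (g x)) has_integral (1 / 1) *\<^sub>R integral {a..b} (\<lambda>s. integral {c..d} (\<lambda>t. (f \<circ> h) (s, t))))
     (h ` cbox (a, c) (b, d))"
  proof (rule has_integral_twiddle[rotated -1])
    show "isCont g x" for x
      unfolding g_def by (intro continuous_intros)
    show "\<exists>w z. g ` cbox u v = cbox w z" for u v using gi by blast
    show "\<exists>w z. h ` cbox u v = cbox w z" for u v using hi by blast
    show "measure lborel (g ` cbox u v) = 1 * measure lborel (cbox u v)" for u v
    proof (cases "cbox u v = {}")
      case False
      then have "u $ 1 \<le> v $ 1" "u $ 2 \<le> v $ 2"
        by (auto simp: mem_box_cart forall_2)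
      then show ?thesis
        unfolding gi content_cbox_cart[OF False] by (simp add: g_def content_Pair UNIV_2)
    qed simp
  qed (use hg gh in auto)
  then show ?thesis by (simp add: hi hg) (simp add: h_def)
qed

lemma has_integral_exp_int:
  "((\<lambda>t. exp (\<i> * of_int k * of_real t)) has_integral (if k = 0 then complex_of_real (2 * pi) else 0)) {0..2*pi}"
proof (cases "k = 0")
  case True
  then show ?thesis
    using has_integral_const_real[of "1::complex" 0 "2*pi"] by (simp add: scaleR_conv_of_real)
next
  case False
  define G where "G t = exp (\<i> * of_int k * complex_of_real t) / (\<i> * of_int k)" for t
  have "((\<lambda>t. exp (\<i> * of_int k * of_real t)) has_integral G (2*pi) - G 0) {0..2*pi}"
    unfolding G_def
  proof (rule fundamental_theorem_of_calculus)
    fix t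
    have "((\<lambda>z. exp (\<i> * of_int k * z) / (\<i> * of_int k)) has_field_derivative exp (\<i> * of_int k * of_real t)) (at (of_real t))"
      using False by (auto intro!: derivative_eq_intros)
    then show "((\<lambda>t. exp (\<i> * of_int k * complex_of_real t) / (\<i> * of_int k)) has_vector_derivative exp (\<i> * of_int k * of_real t)) (at t within {0..2*pi})"
      by (rule has_vector_derivative_real_field[THEN has_vector_derivative_at_within])
  qed simp
  moreover have "exp (\<i> * of_int k * complex_of_real (2 * pi)) = 1"
    by (subst exp_eq_1) (auto simp: intro!: exI[of _ k])
  ultimately show ?thesis using False by (simp add: G_def)
qed

lemma has_integral_Parseval_exp:
  "((\<lambda>t. (cmod (\<Sum>n\<le>N. b n * exp (of_nat n * Complex s t)))\<^sup>2) has_integral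
     2 * pi * (\<Sum>n\<le>N. (cmod (b n))\<^sup>2 * exp (2 * real n * s))) {0..2*pi}"
proof -
  define c where "c n m = b n * cnj (b m) * exp (of_real ((real n + real m) * s))" for n m
  have eq: "(b n * exp (of_nat n * Complex s t)) * cnj (b m * exp (of_nat m * Complex s t)) =
      c n m * exp (\<i> * of_int (int n - int m) * of_real t)" for n m t
    by (simp add: c_def exp_cnj Complex_eq flip: exp_add) (simp add: algebra_simps flip: exp_add)
  have "((\<lambda>t. \<Sum>n\<le>N. \<Sum>m\<le>N. c n m * exp (\<i> * of_int (int n - int m) * of_real t)) has_integral
     (\<Sum>n\<le>N. \<Sum>m\<le>N. c n m * (if int n - int m = 0 then complex_of_real (2 * pi) else 0))) {0..2*pi}"
    by (intro has_integral_sum has_integral_mult_right has_integral_exp_int) auto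
  moreover have "(\<Sum>n\<le>N. \<Sum>m\<le>N. c n m * exp (\<i> * of_int (int n - int m) * of_real t)) =
      complex_of_real ((cmod (\<Sum>n\<le>N. b n * exp (of_nat n * Complex s t)))\<^sup>2)" for t
    unfolding complex_norm_square eq[symmetric] by (simp add: sum_product)
  moreover have "(\<Sum>n\<le>N. \<Sum>m\<le>N. c n m * (if int n - int m = 0 then complex_of_real (2 * pi) else 0)) =
     complex_of_real (2 * pi * (\<Sum>n\<le>N. (cmod (b n))\<^sup>2 * exp (2 * real n * s)))"
  proof -
    have "(\<Sum>n\<le>N. \<Sum>m\<le>N. c n m * (if int n - int m = 0 then complex_of_real (2 * pi) else 0)) =
       (\<Sum>n\<le>N. c n n * complex_of_real (2 * pi))"
      by (intro sum.cong refl) (simp add: if_distrib sum.delta' cong: if_cong)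
    moreover have "c n n = complex_of_real ((cmod (b n))\<^sup>2 * exp (2 * real n * s))" for n
      unfolding of_real_mult complex_norm_square c_def by (simp flip: exp_of_real)
    ultimately show ?thesis by (simp add: sum_distrib_left mult.commute)
  qed
  ultimately have "((\<lambda>t. complex_of_real ((cmod (\<Sum>n\<le>N. b n * exp (of_nat n * Complex s t)))\<^sup>2)) has_integral
     complex_of_real (2 * pi * (\<Sum>n\<le>N. (cmod (b n))\<^sup>2 * exp (2 * real n * s)))) {0..2*pi}"
    by (simp only:)
  from has_integral_linear[OF this bounded_linear_Re] show ?thesis
    by (simp only: o_def Re_complex_of_real)
qed

text \<open>With \<open>w = exp (Complex s t)\<close> the area element pulled back by
  \<open>F\<close> is \<open>|F' w * w|^2 ds dt\<close>, so Parseval in \<open>t\<close> and an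
  integral of exponentials in \<open>s\<close> give the area of the image of an annulus. A nonzero
  \<open>b 0\<close> would contribute a term linear in \<open>s1 - s0\<close>, whereas the division
  by \<open>n = 0\<close> on the right yields 0.\<close>

lemma integral_Parseval_exp:
  assumes "s0 \<le> s1" "b 0 = 0"
  shows "integral {s0..s1} (\<lambda>s. integral {0..2*pi} (\<lambda>t. (cmod (\<Sum>n\<le>N. b n * exp (of_nat n * Complex s t)))\<^sup>2))
    = pi * (\<Sum>n\<le>N. (cmod (b n))\<^sup>2 / n * (exp (2 * real n * s1) - exp (2 * real n * s0)))"
proof -
  have "((\<lambda>s. 2 * pi * (\<Sum>n\<le>N. (cmod (b n))\<^sup>2 * exp (2 * real n * s))) has_integral
     2 * pi * (\<Sum>n\<le>N. (cmod (b n))\<^sup>2 * ((exp (2 * real n * s1) - exp (2 * real n * s0)) / (2 * n)))) {s0..s1}"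
  proof (rule has_integral_mult_right, rule has_integral_sum)
    fix n assume "n \<in> {..N}"
    show "((\<lambda>s. (cmod (b n))\<^sup>2 * exp (2 * real n * s)) has_integral
        (cmod (b n))\<^sup>2 * ((exp (2 * real n * s1) - exp (2 * real n * s0)) / (2 * n))) {s0..s1}"
    proof (cases "n = 0")
      case True then show ?thesis using assms by simp
    next
      case False
      have "((\<lambda>s. exp (2 * real n * s)) has_integral exp (2 * real n * s1) / (2 * n) - exp (2 * real n * s0) / (2 * n)) {s0..s1}"
        by (rule fundamental_theorem_of_calculus)
          (use assms False in \<open>auto intro!: derivative_eq_intros simp flip: has_real_derivative_iff_has_vector_derivative\<close>)
      then show ?thesis by (intro has_integral_mult_right) (simp add: diff_divide_distrib)
    qed
  qed simp
  then have "integral {s0..s1} (\<lambda>s. 2 * pi * (\<Sum>n\<le>N. (cmod (b n))\<^sup>2 * exp (2 * real n * s))) =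
     2 * pi * (\<Sum>n\<le>N. (cmod (b n))\<^sup>2 * ((exp (2 * real n * s1) - exp (2 * real n * s0)) / (2 * n)))"
    by (rule integral_unique)
  also have "\<dots> = pi * (\<Sum>n\<le>N. (cmod (b n))\<^sup>2 / n * (exp (2 * real n * s1) - exp (2 * real n * s0)))"
    by (simp add: sum_distrib_left mult_ac)
  finally show ?thesis
    by (simp add: integral_unique[OF has_integral_Parseval_exp])
qed

text \<open>Change of variables with \<open>exp\<close> in the role of polar coordinates: an open
  strip of height \<open>2 * pi\<close> is mapped injectively, and the real Jacobian is the squared
  modulus of the complex derivative. Holomorphy is assumed on the closed disc but injectivity on the
  open one, so that \<open>s1 = 0\<close> is allowed when \<open>F\<close> is entire.\<close>

lemma measure_image_exp_box:
  fixes F :: "complex \<Rightarrow> complex"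
  defines "B s0 s1 \<equiv> {z. s0 < Re z \<and> Re z < s1 \<and> 0 < Im z \<and> Im z < 2 * pi}"
  assumes F: "F holomorphic_on S" "open S" and sub: "cball 0 (exp s1) \<subseteq> S"
    and inj: "inj_on F (ball 0 (exp s1))"
  shows "rv ` F ` exp ` B s0 s1 \<in> lmeasurable"
    and "measure lebesgue (rv ` F ` exp ` B s0 s1) = integral {s0..s1} (\<lambda>s. integral {0..2*pi}
      (\<lambda>t. (cmod (deriv F (exp (Complex s t)) * exp (Complex s t)))\<^sup>2))"
proof -
  let ?D = "\<lambda>z. deriv F (exp z) * exp z"
  let ?a = "rv (Complex s0 0)" and ?b = "rv (Complex s1 (2 * pi))"
  define \<phi> where "\<phi> x = rv (F (exp (cx x)))" for x
  have box: "box ?a ?b = rv ` B s0 s1"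
    unfolding rv_image_eq_vimage B_def by (auto simp: mem_box_cart forall_2)
  have img: "\<phi> ` box ?a ?b = rv ` F ` exp ` B s0 s1"
    unfolding box \<phi>_def by (simp add: image_image)
  have inS: "exp (cx x) \<in> S" if "x \<in> cbox ?a ?b" for x
    using that sub by (auto simp: mem_box_cart forall_2)
  have der: "(\<phi> has_derivative (\<lambda>h. rv (?D (cx x) * cx h))) (at x within box ?a ?b)" if "x \<in> box ?a ?b" for x
  proof -
    have "(F has_field_derivative deriv F (exp (cx x))) (at (exp (cx x)))"
      using inS[of x] that box_subset_cbox F holomorphic_derivI by blast
    from DERIV_chain2[OF this DERIV_exp]
    have "((\<lambda>z. F (exp z)) has_derivative (\<lambda>h. ?D (cx x) * h)) (at (cx x))"
      by (simp add: has_field_derivative_def)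
    from has_derivative_compose[OF bounded_linear_imp_has_derivative[OF bounded_linear_cx] this]
    have "((\<lambda>x. F (exp (cx x))) has_derivative (\<lambda>h. ?D (cx x) * cx h)) (at x)" .
    from bounded_linear.has_derivative[OF bounded_linear_rv this] show ?thesis
      unfolding \<phi>_def by (rule has_derivative_at_withinI)
  qed
  have det: "\<bar>det (matrix (\<lambda>h. rv (D * cx h)))\<bar> = (cmod D)\<^sup>2" for D
    unfolding det_2 matrix_def by (simp add: axis_def cmod_power2) (simp add: power2_eq_square)
  have injb: "inj_on \<phi> (box ?a ?b)"
  proof (rule inj_onI)
    fix x y assume xy: "x \<in> box ?a ?b" "y \<in> box ?a ?b" "\<phi> x = \<phi> y"
    have "exp (cx x) \<in> ball 0 (exp s1)" "exp (cx y) \<in> ball 0 (exp s1)"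
      using xy by (auto simp: mem_box_cart forall_2)
    moreover have "F (exp (cx x)) = F (exp (cx y))"
      using xy(3) unfolding \<phi>_def by (metis cx_rv)
    ultimately have "exp (cx x) = exp (cx y)" using inj by (auto dest: inj_onD)
    then have "cx x = cx y"
      by (rule exp_complex_eqI[rotated]) (use xy in \<open>auto simp: mem_box_cart forall_2 abs_less_iff\<close>)
    then show "x = y" by (metis rv_cx)
  qed
  have cont: "continuous_on (cbox ?a ?b) (\<lambda>x. (cmod (?D (cx x)))\<^sup>2)"
  proof -
    have "continuous_on S (deriv F)"
      using F holomorphic_deriv holomorphic_on_imp_continuous_on by blast
    then have "continuous_on (cbox ?a ?b) (\<lambda>x. deriv F (exp (cx x)))"
      by (rule continuous_on_compose2) (use inS in \<open>auto intro!: continuous_intros\<close>)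
    then show ?thesis by (intro continuous_intros)
  qed
  have "((\<lambda>x. (cmod (?D (cx x)))\<^sup>2) has_integral integral {s0..s1} (\<lambda>s. integral {0..2*pi}
      (\<lambda>t. (cmod (?D (Complex s t)))\<^sup>2))) (box ?a ?b)"
    using has_integral_rv_iterated[OF cont] by (simp add: has_integral_open_interval)
  then have "((\<lambda>x. \<bar>det (matrix (\<lambda>h. rv (?D (cx x) * cx h)))\<bar>) has_integral integral {s0..s1} (\<lambda>s. integral {0..2*pi}
      (\<lambda>t. (cmod (?D (Complex s t)))\<^sup>2))) (box ?a ?b)"
    by (simp only: det)
  then have "\<phi> ` box ?a ?b \<in> lmeasurable \<and> measure lebesgue (\<phi> ` box ?a ?b) =
      integral {s0..s1} (\<lambda>s. integral {0..2*pi} (\<lambda>t. (cmod (?D (Complex s t)))\<^sup>2))"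
    by (subst has_measure_differentiable_image[OF _ der injb]) auto
  then show "rv ` F ` exp ` B s0 s1 \<in> lmeasurable"
    "measure lebesgue (rv ` F ` exp ` B s0 s1) = integral {s0..s1} (\<lambda>s. integral {0..2*pi}
      (\<lambda>t. (cmod (deriv F (exp (Complex s t)) * exp (Complex s t)))\<^sup>2))"
    unfolding img by auto
qed

section \<open>Taylor coefficients\<close>

definition taylor_coeff :: "(complex \<Rightarrow> complex) \<Rightarrow> nat \<Rightarrow> complex" where
  "taylor_coeff F n = (deriv ^^ n) F 0 / fact n"

lemma uniform_limit_taylor:
  assumes F: "F holomorphic_on ball 0 1" and r: "r < 1"
  shows "uniform_limit (cball 0 r) (\<lambda>N w. \<Sum>n<N. taylor_coeff F n * w ^ n) F sequentially"
proof (cases "r < 0")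
  case True then show ?thesis by simp
next
  case False
  have sums: "(\<lambda>n. taylor_coeff F n * w ^ n) sums F w" if "w \<in> ball 0 1" for w
    using holomorphic_power_series[OF F that] by (simp add: taylor_coeff_def)
  have "norm (of_real ((1 + r) / 2) :: complex) \<le> conv_radius (taylor_coeff F)"
    using False r by (intro conv_radius_geI sums_summable[OF sums]) (auto simp: simp flip: of_real_add)
  moreover have "ereal r < norm (of_real ((1 + r) / 2) :: complex)"
    using False r by (simp flip: of_real_add)
  ultimately have "ereal r < conv_radius (taylor_coeff F)" by (rule order.strict_trans2[rotated])
  from powser_uniform_limit[OF this, of 0]
  have "uniform_limit (cball 0 r) (\<lambda>N w. \<Sum>n<N. taylor_coeff F n * w ^ n) (\<lambda>w. \<Sum>n. taylor_coeff F n * w ^ n) sequentially"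
    by simp
  moreover have eq: "(\<Sum>n. taylor_coeff F n * w ^ n) = F w" if "w \<in> cball 0 r" for w
    using sums_unique[OF sums[of w]] that r by simp
  have "uniform_limit (cball 0 r) (\<lambda>N w. \<Sum>n<N. taylor_coeff F n * w ^ n) (\<lambda>w. \<Sum>n. taylor_coeff F n * w ^ n) sequentially
     \<longleftrightarrow> uniform_limit (cball 0 r) (\<lambda>N w. \<Sum>n<N. taylor_coeff F n * w ^ n) F sequentially"
    by (rule uniform_limit_cong') (auto simp: eq)
  ultimately show ?thesis by (simp only:)
qed

lemma taylor_coeff_times_deriv:
  assumes F: "F holomorphic_on ball 0 1" and M: "M > 0"
  shows "(\<Sum>n<M. taylor_coeff (deriv F) n * w ^ n) * w = (\<Sum>n\<le>M. of_nat n * taylor_coeff F n * w ^ n)"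
proof -
  have c: "taylor_coeff (deriv F) n = of_nat (Suc n) * taylor_coeff F (Suc n)" for n
    by (simp add: taylor_coeff_def funpow_Suc_right del: funpow.simps of_nat_Suc)
  have "(\<Sum>n<M. taylor_coeff (deriv F) n * w ^ n) * w = (\<Sum>n<M. of_nat (Suc n) * taylor_coeff F (Suc n) * w ^ Suc n)"
    unfolding sum_distrib_right c by (intro sum.cong refl) (simp add: mult_ac del: of_nat_Suc)
  also have "\<dots> = (\<Sum>n\<le>M. of_nat n * taylor_coeff F n * w ^ n)"
    by (subst sum.atMost_shift) simp
  finally show ?thesis .
qed

text \<open>On the annulus \<open>w * F' w\<close> is uniformly close to one of its Taylor
  polynomials, of degree \<open>M >= N\<close>, so Parseval for polynomials suffices. The terms
  between \<open>N\<close> and \<open>M\<close> are nonnegative and are dropped.\<close>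

lemma area_ge_taylor_coeffs_annulus:
  assumes F: "F holomorphic_on ball 0 1" and inj: "inj_on F (ball 0 1)"
    and img: "rv ` F ` ball 0 1 \<subseteq> \<Omega>" and \<Omega>: "\<Omega> \<in> lmeasurable" and s: "s0 \<le> s1" "s1 < 0"
  shows "pi * (\<Sum>n\<le>N. real n * (cmod (taylor_coeff F n))\<^sup>2 * (exp (2 * real n * s1) - exp (2 * real n * s0))) \<le> measure lebesgue \<Omega>"
proof (rule field_le_epsilon)
  fix \<epsilon> :: real assume "\<epsilon> > 0"
  let ?a = "rv (Complex s0 0)" and ?b = "rv (Complex s1 (2 * pi))"
  define r where "r = exp s1"
  have r: "0 < r" "r < 1" using s by (auto simp: r_def)
  have sub: "cball 0 r \<subseteq> ball (0::complex) 1" using r by auto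
  define h where "h w = deriv F w * w" for w
  have dF: "deriv F holomorphic_on ball 0 1" using F holomorphic_deriv by blast
  have conth: "continuous_on (cball 0 r) h"
    unfolding h_def using holomorphic_on_imp_continuous_on[OF dF] sub
    by (intro continuous_intros) (blast intro: continuous_on_subset)
  obtain K where K: "K \<ge> 0" "\<And>w. w \<in> cball 0 r \<Longrightarrow> cmod (h w) \<le> K"
  proof -
    have "bounded (h ` cball 0 r)" by (intro compact_imp_bounded compact_continuous_image conth) auto
    then show ?thesis using that unfolding bounded_pos by (metis image_eqI less_imp_le)
  qed
  define C where "C = measure lborel (cbox ?a ?b)"
  have "C \<ge> 0" by (simp add: C_def)
  define \<eta> where "\<eta> = \<epsilon> / (C + 1)"
  have \<eta>: "\<eta> > 0" "\<eta> * C \<le> \<epsilon>"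
    using \<open>\<epsilon> > 0\<close> \<open>C \<ge> 0\<close> by (auto simp: \<eta>_def field_simps)
  \<comment> \<open>Since
    \<open>(|h| + \<delta>)^2 - |h|^2 = \<delta> * (2 * |h| + \<delta>)\<close> and
    \<open>\<delta> <= 1\<close>, this keeps the error in the squared modulus below
    \<open>\<eta>\<close>.\<close>
  define \<delta> where "\<delta> = min 1 (\<eta> / (2 * K + 1))"
  have "\<delta> \<le> \<eta> / (2 * K + 1)" by (simp add: \<delta>_def)
  then have "\<delta> * (2 * K + 1) \<le> \<eta>"
    using K(1) by (simp add: pos_le_divide_eq)
  then have \<delta>: "0 < \<delta>" "\<delta> \<le> 1" "\<delta> * (2 * K + 1) \<le> \<eta>"
    using \<eta> K(1) by (auto simp: \<delta>_def)
  define P where "P M w = (\<Sum>n\<le>M. of_nat n * taylor_coeff F n * w ^ n)" for M and w :: complex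
  obtain M where M: "M \<ge> N" "M > 0" "\<And>w. w \<in> cball 0 r \<Longrightarrow> cmod (P M w - h w) \<le> \<delta>"
  proof -
    have "\<forall>\<^sub>F M in sequentially. \<forall>w\<in>cball 0 r. dist (\<Sum>n<M. taylor_coeff (deriv F) n * w ^ n) (deriv F w) < \<delta>"
      using uniform_limit_taylor[OF dF r(2)] \<delta>(1) by (rule uniform_limitD)
    then obtain M0 where M0: "\<And>M w. M \<ge> M0 \<Longrightarrow> w \<in> cball 0 r \<Longrightarrow> dist (\<Sum>n<M. taylor_coeff (deriv F) n * w ^ n) (deriv F w) < \<delta>"
      unfolding eventually_sequentially by blast
    define M where "M = max (max M0 N) 1"
    have "M0 \<le> M" by (simp add: M_def)
    have "cmod (P M w - h w) \<le> \<delta>" if w: "w \<in> cball 0 r" for w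
    proof -
      have "P M w - h w = ((\<Sum>n<M. taylor_coeff (deriv F) n * w ^ n) - deriv F w) * w"
        unfolding P_def h_def by (subst taylor_coeff_times_deriv[OF F, symmetric]) (auto simp: M_def left_diff_distrib)
      also have "cmod \<dots> \<le> \<delta> * 1"
        unfolding norm_mult using M0[of M w] \<open>M0 \<le> M\<close> w r \<delta>(1) by (intro mult_mono) (auto simp: dist_norm)
      finally show ?thesis by simp
    qed
    then show ?thesis using that[of M] by (auto simp: M_def)
  qed
  have le: "(cmod (P M w))\<^sup>2 \<le> (cmod (h w))\<^sup>2 + \<eta>" if "w \<in> cball 0 r" for w
  proof -
    have "cmod (P M w) \<le> cmod (h w) + \<delta>"
      using M(3)[OF that] norm_triangle_ineq[of "P M w - h w" "h w"] by simp
    then have "(cmod (P M w))\<^sup>2 \<le> (cmod (h w) + \<delta>)\<^sup>2" by (intro power_mono) auto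
    also have "\<dots> = (cmod (h w))\<^sup>2 + \<delta> * (2 * cmod (h w) + \<delta>)" by (simp add: power2_eq_square algebra_simps)
    also have "\<delta> * (2 * cmod (h w) + \<delta>) \<le> \<delta> * (2 * K + 1)"
      using K(2)[OF that] \<delta> by (intro mult_left_mono) auto
    finally show ?thesis using \<delta>(3) by linarith
  qed
  have inr: "exp (cx x) \<in> cball 0 r" if "x \<in> cbox ?a ?b" for x
    using that by (auto simp: mem_box_cart forall_2 r_def)
  have c1: "continuous_on (cbox ?a ?b) (\<lambda>x. (cmod (P M (exp (cx x))))\<^sup>2)"
    unfolding P_def by (intro continuous_intros)
  have "continuous_on (cbox ?a ?b) (\<lambda>x. h (exp (cx x)))"
    by (rule continuous_on_compose2[OF conth]) (use inr in \<open>auto intro!: continuous_intros\<close>)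
  then have c2: "continuous_on (cbox ?a ?b) (\<lambda>x. (cmod (h (exp (cx x))))\<^sup>2)"
    by (intro continuous_intros)
  define I1 where "I1 = integral {s0..s1} (\<lambda>s. integral {0..2*pi} (\<lambda>t. (cmod (P M (exp (Complex s t))))\<^sup>2))"
  define I2 where "I2 = integral {s0..s1} (\<lambda>s. integral {0..2*pi} (\<lambda>t. (cmod (h (exp (Complex s t))))\<^sup>2))"
  have "((\<lambda>x. (cmod (P M (exp (cx x))))\<^sup>2) has_integral I1) (cbox ?a ?b)"
    using has_integral_rv_iterated[OF c1] by (simp add: I1_def)
  moreover have "((\<lambda>x. (cmod (h (exp (cx x))))\<^sup>2 + \<eta>) has_integral I2 + C *\<^sub>R \<eta>) (cbox ?a ?b)"
    unfolding C_def using has_integral_rv_iterated[OF c2] by (intro has_integral_add has_integral_const) (simp add: I2_def)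
  ultimately have "I1 \<le> I2 + C *\<^sub>R \<eta>"
    by (rule has_integral_le) (use le inr in auto)
  moreover have "I2 \<le> measure lebesgue \<Omega>"
  proof -
    have s1: "cball 0 (exp s1) \<subseteq> ball (0::complex) 1" using sub by (simp add: r_def)
    have injr: "inj_on F (ball 0 (exp s1))"
      by (rule inj_on_subset[OF inj]) (rule subset_ball, use s in simp)
    note m = measure_image_exp_box[OF F open_ball s1 injr, of s0]
    have "I2 = measure lebesgue (rv ` F ` exp ` {z. s0 < Re z \<and> Re z < s1 \<and> 0 < Im z \<and> Im z < 2 * pi})"
      unfolding m(2) I2_def h_def ..
    also have "\<dots> \<le> measure lebesgue \<Omega>"
    proof (rule measure_mono_fmeasurable)
      have "exp ` {z. s0 < Re z \<and> Re z < s1 \<and> 0 < Im z \<and> Im z < 2 * pi} \<subseteq> ball (0::complex) 1"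
        using s by auto
      then show "rv ` F ` exp ` {z. s0 < Re z \<and> Re z < s1 \<and> 0 < Im z \<and> Im z < 2 * pi} \<subseteq> \<Omega>"
        using img by blast
    qed (use m(1) \<Omega> in auto)
    finally show ?thesis .
  qed
  moreover have "pi * (\<Sum>n\<le>N. real n * (cmod (taylor_coeff F n))\<^sup>2 * (exp (2 * real n * s1) - exp (2 * real n * s0))) \<le> I1"
  proof -
    have "I1 = integral {s0..s1} (\<lambda>s. integral {0..2*pi} (\<lambda>t. (cmod (\<Sum>n\<le>M. (of_nat n * taylor_coeff F n) * exp (of_nat n * Complex s t)))\<^sup>2))"
      by (simp add: I1_def P_def exp_of_nat_mult)
    also have "\<dots> = pi * (\<Sum>n\<le>M. (cmod (of_nat n * taylor_coeff F n))\<^sup>2 / n * (exp (2 * real n * s1) - exp (2 * real n * s0)))"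
      by (rule integral_Parseval_exp) (use s in auto)
    also have "\<dots> = pi * (\<Sum>n\<le>M. real n * (cmod (taylor_coeff F n))\<^sup>2 * (exp (2 * real n * s1) - exp (2 * real n * s0)))"
      by (intro arg_cong[where f = "\<lambda>x. pi * x"] sum.cong refl) (simp add: norm_mult power2_eq_square)
    also have "\<dots> \<ge> pi * (\<Sum>n\<le>N. real n * (cmod (taylor_coeff F n))\<^sup>2 * (exp (2 * real n * s1) - exp (2 * real n * s0)))"
      using M(1) s by (intro mult_left_mono sum_mono2) (auto intro!: mult_nonneg_nonneg mult_left_mono)
    finally show ?thesis .
  qed
  ultimately show "pi * (\<Sum>n\<le>N. real n * (cmod (taylor_coeff F n))\<^sup>2 * (exp (2 * real n * s1) - exp (2 * real n * s0))) \<le> measure lebesgue \<Omega> + \<epsilon>"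
    using \<eta>(2) by (simp add: mult.commute)
qed

lemma area_ge_taylor_coeffs:
  assumes F: "F holomorphic_on ball 0 1" and inj: "inj_on F (ball 0 1)"
    and img: "rv ` F ` ball 0 1 \<subseteq> \<Omega>" and \<Omega>: "\<Omega> \<in> lmeasurable"
  shows "pi * (\<Sum>n\<le>N. real n * (cmod (taylor_coeff F n))\<^sup>2) \<le> measure lebesgue \<Omega>"
proof -
  \<comment> \<open>The annuli with \<open>s1 = - 1 / (j + 1)\<close> and
    \<open>s0 = - (j + 1)\<close> exhaust the punctured disc, so each factor tends to 1 for
    \<open>n > 0\<close>.\<close>
  let ?e = "\<lambda>j n. exp (2 * real n * (- inverse (real (Suc j)))) - exp (2 * real n * (- real (Suc j)))"
  have lim: "(\<lambda>j. real n * (cmod (taylor_coeff F n))\<^sup>2 * ?e j n) \<longlonglongrightarrow> real n * (cmod (taylor_coeff F n))\<^sup>2" for n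
  proof (cases "n = 0")
    case False
    have "(\<lambda>j. exp (2 * real n * (- inverse (real (Suc j))))) \<longlonglongrightarrow> exp (2 * real n * (- 0))"
      by (intro tendsto_intros LIMSEQ_inverse_real_of_nat)
    moreover have "(\<lambda>j. exp (2 * real n * (- real (Suc j)))) \<longlonglongrightarrow> 0"
      using False by (real_asymp)
    ultimately have "(\<lambda>j. ?e j n) \<longlonglongrightarrow> exp (2 * real n * (- 0)) - 0" by (rule tendsto_diff)
    then have "(\<lambda>j. real n * (cmod (taylor_coeff F n))\<^sup>2 * ?e j n) \<longlonglongrightarrow> real n * (cmod (taylor_coeff F n))\<^sup>2 * (exp (2 * real n * (- 0)) - 0)"
      by (rule tendsto_mult_left)
    then show ?thesis by simp
  qed simp
  have "(\<lambda>j. pi * (\<Sum>n\<le>N. real n * (cmod (taylor_coeff F n))\<^sup>2 * ?e j n)) \<longlonglongrightarrow> pi * (\<Sum>n\<le>N. real n * (cmod (taylor_coeff F n))\<^sup>2)"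
    by (intro tendsto_mult_left tendsto_sum lim)
  then show ?thesis
  proof (rule LIMSEQ_le_const2)
    have "pi * (\<Sum>n\<le>N. real n * (cmod (taylor_coeff F n))\<^sup>2 * ?e j n) \<le> measure lebesgue \<Omega>" for j
      by (rule area_ge_taylor_coeffs_annulus[OF assms]) (auto simp: field_simps)
    then show "\<exists>N'. \<forall>j\<ge>N'. pi * (\<Sum>n\<le>N. real n * (cmod (taylor_coeff F n))\<^sup>2 * ?e j n) \<le> measure lebesgue \<Omega>" by blast
  qed
qed

text \<open>On the circle \<open>cnj w = r^2 / w\<close>, so each product
  \<open>w^n * cnj w^m\<close> is a multiple of a power of \<open>w\<close> or of
  \<open>cnj w\<close>. Conjugating the latter kind keeps the real part and leaves a polynomial, an
  explicit harmonic extension of the squared modulus; its value at 0 collects the diagonal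
  terms.\<close>

lemma norm_square_on_circle_eq_Re_entire:
  fixes b :: "nat \<Rightarrow> complex"
  assumes r: "r > 0"
  shows "\<exists>Q. Q holomorphic_on UNIV \<and>
    (\<forall>w. cmod w = r \<longrightarrow> Re (Q w) = (cmod (\<Sum>n\<le>N. b n * w ^ n))\<^sup>2) \<and>
    Re (Q 0) = (\<Sum>n\<le>N. (cmod (b n))\<^sup>2 * r ^ (2 * n))"
proof -
  define q where "q n m w = (if m \<le> n then b n * cnj (b m) * of_real (r ^ (2 * m)) * w ^ (n - m)
      else cnj (b n) * b m * of_real (r ^ (2 * n)) * w ^ (m - n))" for n m and w :: complex
  define Q where "Q w = (\<Sum>n\<le>N. \<Sum>m\<le>N. q n m w)" for w
  have Q_hol: "Q holomorphic_on UNIV"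
  proof -
    have "q n m holomorphic_on UNIV" for n m
      unfolding q_def by (cases "m \<le> n") (auto intro!: holomorphic_intros)
    then show ?thesis unfolding Q_def by (intro holomorphic_on_sum) auto
  qed
  have Q_circle: "Re (Q w) = (cmod (\<Sum>n\<le>N. b n * w ^ n))\<^sup>2" if w: "cmod w = r" for w
  proof -
    have ww: "w * cnj w = of_real (r ^ 2)" using w by (simp add: complex_norm_square[symmetric])
    have pw: "w ^ n * cnj w ^ m = of_real (r ^ (2 * m)) * w ^ (n - m)" if "m \<le> n" for n m
    proof -
      have "w ^ n * cnj w ^ m = w ^ (n - m) * (w * cnj w) ^ m"
        using that by (simp add: power_mult_distrib flip: power_add mult.assoc)
      then show ?thesis unfolding ww by (simp add: power_mult)
    qed
    have "Re (q n m w) = Re ((b n * w ^ n) * cnj (b m * w ^ m))" for n m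
    proof (cases "m \<le> n")
      case True
      have "(b n * w ^ n) * cnj (b m * w ^ m) = b n * cnj (b m) * (w ^ n * cnj w ^ m)" by simp
      also have "\<dots> = q n m w" using True by (simp only: pw[OF True] q_def if_True mult.assoc)
      finally show ?thesis by simp
    next
      case False
      then have *: "n \<le> m" by simp
      have "cnj ((b n * w ^ n) * cnj (b m * w ^ m)) = cnj (b n) * b m * (w ^ m * cnj w ^ n)" by simp
      also have "\<dots> = q n m w" using False by (simp only: pw[OF *] q_def if_False mult.assoc)
      finally show ?thesis by (metis cnj.simps(1))
    qed
    then have "Re (Q w) = Re ((\<Sum>n\<le>N. b n * w ^ n) * cnj (\<Sum>n\<le>N. b n * w ^ n))"
      unfolding Q_def cnj_sum sum_product Re_sum by simp
    then show ?thesis by (simp only: complex_norm_square[symmetric] Re_complex_of_real)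
  qed
  have "Re (q n m 0) = (if m = n then (cmod (b n))\<^sup>2 * r ^ (2 * n) else 0)" for n m
    by (simp add: q_def complex_norm_square[symmetric] power_0_left flip: of_real_mult)
  then have "Re (Q 0) = (\<Sum>n\<le>N. (cmod (b n))\<^sup>2 * r ^ (2 * n))"
    unfolding Q_def by (simp add: sum.delta)
  then show ?thesis using Q_hol Q_circle by blast
qed

text \<open>Integrates \<open>Re k\<close> against the nonnegative trigonometric polynomial \<open>4 (1 - cos \<theta>)\<^sup>2\<close> on the
  circle of radius \<open>r\<close>.\<close>

lemma positive_real_part_coeff_aux:
  assumes k: "k holomorphic_on ball 0 1" and pos: "\<And>w. w \<in> ball 0 1 \<Longrightarrow> Re (k w) > 0"
    and r: "0 < r" "r < 1"
  shows "0 \<le> 6 * Re (k 0) - 4 * r * Re (deriv k 0) + r\<^sup>2 * Re (deriv (deriv k) 0) / 2"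
proof -
  let ?\<gamma> = "circlepath 0 r"
  have sub: "cball 0 r \<subseteq> ball (0::complex) 1" using r by auto
  have cont: "continuous_on (cball 0 r) k"
    using holomorphic_on_imp_continuous_on[OF k] sub continuous_on_subset by blast
  have hol: "k holomorphic_on ball 0 r"
    using k holomorphic_on_subset r by (metis ball_subset_cball order_trans sub)
  have C: "((\<lambda>u. k u / u ^ Suc j) has_contour_integral (2 * pi * \<i>) / fact j * (deriv ^^ j) k 0) ?\<gamma>" for j
    using Cauchy_has_contour_integral_higher_derivative_circlepath[OF cont hol, of 0 j] r by simp
  have Z: "(h has_contour_integral 0) ?\<gamma>" if "h holomorphic_on ball 0 1" for h
    by (rule Cauchy_theorem_disc_simple[OF that]) (use r sub in auto)
  define J where "J = deriv (deriv k) 0 / 2 - 4 / r * deriv k 0 + 6 / r\<^sup>2 * k 0"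
  \<comment> \<open>The weights 1, -4, 6, -4, 1 come from expanding \<open>(W - 2 + 1 / W)^2\<close>
    with \<open>W = u / r\<close>. The last two terms are holomorphic and integrate to 0; the first
    three produce the derivatives of \<open>k\<close> at 0 by Cauchy's formula.\<close>
  define \<Phi> where "\<Phi> u = k u / u ^ Suc 2 + (- 4 / r) * (k u / u ^ Suc 1) + (6 / r\<^sup>2) * (k u / u ^ Suc 0)
      + (-4 / r ^ 3) * k u + (1 / r ^ 4) * (k u * u)" for u
  have "(\<Phi> has_contour_integral (2 * pi * \<i>) / fact 2 * (deriv ^^ 2) k 0 + (- 4 / r) * ((2 * pi * \<i>) / fact 1 * (deriv ^^ 1) k 0)
     + (6 / r\<^sup>2) * ((2 * pi * \<i>) / fact 0 * (deriv ^^ 0) k 0) + (-4 / r ^ 3) * (0::complex) + (1 / r ^ 4) * (0::complex)) ?\<gamma>"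
    unfolding \<Phi>_def
    by (intro has_contour_integral_add has_contour_integral_lmul C Z k holomorphic_intros)
  then have "(\<Phi> has_contour_integral 2 * pi * \<i> * J) ?\<gamma>"
    by (rule back_subst[where P = "\<lambda>I. (\<Phi> has_contour_integral I) ?\<gamma>"])
      (simp add: J_def numeral_2_eq_2 field_simps)
  then have I: "((\<lambda>t. \<Phi> (?\<gamma> t) * vector_derivative ?\<gamma> (at t within {0..1})) has_integral 2 * pi * \<i> * J) {0..1}"
    by (simp add: has_contour_integral_def)
  define T where "T t = 4 * (1 - cos (2 * pi * t))\<^sup>2" for t :: real
  have eq: "\<Phi> (?\<gamma> t) * vector_derivative ?\<gamma> (at t within {0..1}) = 2 * pi * \<i> / r\<^sup>2 * (k (?\<gamma> t) * of_real (T t))"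
    if t: "t \<in> {0..1}" for t
  proof -
    define W where "W = exp (2 * of_real pi * \<i> * of_real t)"
    have g: "?\<gamma> t = r * W" by (simp add: circlepath W_def)
    have W0: "W \<noteq> 0" by (simp add: W_def)
    have vd: "vector_derivative ?\<gamma> (at t within {0..1}) = 2 * pi * \<i> * (r * W)"
      using t by (simp add: vector_derivative_circlepath01 W_def mult_ac)
    have "\<Phi> (r * W) * (2 * pi * \<i> * (r * W)) = 2 * pi * \<i> / r\<^sup>2 * (k (r * W) * ((W - 2 + 1 / W)\<^sup>2))"
      unfolding \<Phi>_def using W0 r by (simp add: field_simps power2_eq_square power3_eq_cube power4_eq_xxxx)
    moreover have "W - 2 + 1 / W = of_real (2 * cos (2 * pi * t) - 2)"
    proof -
      have "W = cis (2 * pi * t)" by (simp add: W_def cis_conv_exp mult_ac)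
      moreover have "1 / W = cis (- (2 * pi * t))" using calculation by (simp add: cis_inverse flip: inverse_eq_divide)
      ultimately show ?thesis by (simp add: complex_eq_iff)
    qed
    then have "(W - 2 + 1 / W)\<^sup>2 = of_real (T t)"
      by (simp add: T_def power2_eq_square algebra_simps)
    ultimately show ?thesis
      unfolding g vd by (simp only:)
  qed
  have "((\<lambda>t. 2 * pi * \<i> / r\<^sup>2 * (k (?\<gamma> t) * of_real (T t))) has_integral 2 * pi * \<i> * J) {0..1}"
    using has_integral_eq[OF eq I] by simp
  from has_integral_mult_right[OF this, of "r\<^sup>2 / (2 * pi * \<i>)"]
  have "((\<lambda>t. k (?\<gamma> t) * of_real (T t)) has_integral r\<^sup>2 * J) {0..1}"
    using r by (simp add: field_simps)
  from has_integral_linear[OF this bounded_linear_Re]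
  have "((\<lambda>t. Re (k (?\<gamma> t)) * T t) has_integral Re (r\<^sup>2 * J)) {0..1}"
    by (simp add: o_def)
  then have "0 \<le> Re (r\<^sup>2 * J)"
  proof (rule has_integral_nonneg)
    fix t :: real assume "t \<in> {0..1}"
    have "?\<gamma> t \<in> ball 0 1" using r by (simp add: circlepath norm_mult)
    then show "0 \<le> Re (k (?\<gamma> t)) * T t" using pos[of "?\<gamma> t"] by (simp add: T_def)
  qed
  also have "r\<^sup>2 * J = of_real (r\<^sup>2 / 2) * deriv (deriv k) 0 - of_real (4 * r) * deriv k 0 + 6 * k 0"
    using r by (simp add: J_def field_simps power2_eq_square)
  finally show ?thesis by simp
qed

text \<open>Rotating the variable makes \<open>deriv k 0\<close> a nonnegative real, and then
  \<open>r\<close> tends to 1. The Cayley map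
  \<open>(1 + w) / (1 - w) = 1 + 2 w + 2 w^2 + ...\<close> attains equality: a first coefficient
  near its extremal value 2 forces a large second one.\<close>

lemma positive_real_part_coeff:
  assumes k: "k holomorphic_on ball 0 1" and pos: "\<And>w. w \<in> ball 0 1 \<Longrightarrow> Re (k w) > 0"
  shows "4 * cmod (deriv k 0) - 6 * Re (k 0) \<le> cmod (deriv (deriv k) 0) / 2"
proof -
  obtain \<alpha> where \<alpha>: "cmod \<alpha> = 1" "\<alpha> * deriv k 0 = cmod (deriv k 0)"
  proof (cases "deriv k 0 = 0")
    case True then show ?thesis using that[of 1] by simp
  next
    case False
    then show ?thesis
      using that[of "cnj (deriv k 0) / cmod (deriv k 0)"]
      by (simp add: norm_divide complex_norm_square[symmetric] power2_eq_square field_simps)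
  qed
  define h where "h w = k (\<alpha> * w)" for w
  have ball: "\<alpha> * w \<in> ball 0 1" if "w \<in> ball 0 1" for w
    using that \<alpha> by (simp add: norm_mult)
  have h: "h holomorphic_on ball 0 1"
    unfolding h_def by (intro holomorphic_on_compose_gen[OF _ k, unfolded o_def] holomorphic_intros) (use ball in auto)
  have hd: "(deriv ^^ n) h 0 = \<alpha> ^ n * (deriv ^^ n) k 0" for n
    unfolding h_def using higher_deriv_compose_linear[OF k, of "ball 0 1" 0 \<alpha> n] ball by simp
  have "h 0 = k 0" by (simp add: h_def)
  have main: "0 \<le> 6 * Re (h 0) - 4 * r * Re (deriv h 0) + r\<^sup>2 * Re (deriv (deriv h) 0) / 2" if "0 < r" "r < 1" for r
    using positive_real_part_coeff_aux[OF h _ that] pos ball by (simp add: h_def)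
  have "((\<lambda>r. 6 * Re (h 0) - 4 * r * Re (deriv h 0) + r\<^sup>2 * Re (deriv (deriv h) 0) / 2) \<longlongrightarrow>
     6 * Re (h 0) - 4 * 1 * Re (deriv h 0) + 1\<^sup>2 * Re (deriv (deriv h) 0) / 2) (at_left 1)"
    by (intro tendsto_intros) simp_all
  moreover have "\<forall>\<^sub>F r in at_left 1. 0 \<le> 6 * Re (h 0) - 4 * r * Re (deriv h 0) + r\<^sup>2 * Re (deriv (deriv h) 0) / 2"
    using eventually_at_left_real[of 0 "1::real"] by (auto elim!: eventually_mono intro!: main)
  ultimately have "0 \<le> 6 * Re (h 0) - 4 * 1 * Re (deriv h 0) + 1\<^sup>2 * Re (deriv (deriv h) 0) / 2"
    by (rule tendsto_lowerbound) simp
  moreover have "deriv h 0 = cmod (deriv k 0)" using hd[of 1] \<alpha> by simp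
  moreover have "Re (deriv (deriv h) 0) \<le> cmod (deriv (deriv k) 0)"
  proof -
    have "deriv (deriv h) 0 = \<alpha> ^ 2 * deriv (deriv k) 0" using hd[of 2] by (simp add: numeral_2_eq_2)
    then have "cmod (deriv (deriv h) 0) = cmod (deriv (deriv k) 0)" using \<alpha> by (simp add: norm_mult norm_power)
    then show ?thesis using complex_Re_le_cmod by metis
  qed
  ultimately show ?thesis using \<open>h 0 = k 0\<close> by simp
qed

section \<open>The torsion function at the centre of a Riemann map\<close>

text \<open>\<open>u + |x - p|^2 / 4\<close> is harmonic with value \<open>u p\<close> at
  \<open>p\<close>, and on the image of the circle \<open>|w| = r\<close> it is nearly
  \<open>|F w - F 0|^2 / 4\<close>. The harmonic function with the latter boundary values is
  \<open>Re Q / 4\<close> up to the Taylor error, and \<open>Re (Q 0)\<close> is a sum of weighted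
  squares of coefficients.\<close>

lemma torsion_le_taylor_coeffs:
  assumes dom: "bounded_convex_domain \<Omega>" and tors: "torsion_function \<Omega> u"
    and F: "F holomorphic_on ball 0 1" and G: "G holomorphic_on cx ` \<Omega>"
    and FG: "\<And>z. z \<in> cx ` \<Omega> \<Longrightarrow> G z \<in> ball 0 1 \<and> F (G z) = z"
    and GF: "\<And>w. w \<in> ball 0 1 \<Longrightarrow> F w \<in> cx ` \<Omega> \<and> G (F w) = w"
    and p: "F 0 = cx p"
    and S: "\<And>N. (\<Sum>n=1..N. (cmod (taylor_coeff F n))\<^sup>2) \<le> S"
  shows "u p \<le> S / 4"
proof (rule field_le_epsilon)
  fix \<epsilon>' :: real assume "\<epsilon>' > 0"
  define \<epsilon> where "\<epsilon> = \<epsilon>' / 2"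
  have \<epsilon>: "\<epsilon> > 0" using \<open>\<epsilon>' > 0\<close> by (simp add: \<epsilon>_def)
  have \<Omega>: "open \<Omega>" "bounded \<Omega>" using dom by (auto simp: bounded_convex_domain_def)
  have ucont: "continuous_on (closure \<Omega>) u" and u0: "\<And>x. x \<in> frontier \<Omega> \<Longrightarrow> u x = 0"
    using tors by (auto simp: torsion_function_def)
  \<comment> \<open>This superlevel set is compact inside \<open>\<Omega>\<close>, so
    \<open>G\<close> maps it into a disc of radius \<open>r0 < 1\<close>; beyond that disc
    \<open>u <= \<epsilon>\<close>. Continuity of \<open>u\<close> on the closure thus controls it
    on the image of the circle.\<close>
  define K where "K = {x \<in> closure \<Omega>. \<epsilon> \<le> u x}"
  have "closed (closure \<Omega> \<inter> u -` {\<epsilon>..})"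
    by (rule continuous_closed_preimage[OF ucont]) auto
  moreover have "bounded (closure \<Omega> \<inter> u -` {\<epsilon>..})"
    using \<Omega>(2) bounded_closure bounded_subset by (metis inf_le1)
  ultimately have K: "compact K"
    by (simp add: K_def vimage_def Int_def compact_eq_bounded_closed)
  have K\<Omega>: "K \<subseteq> \<Omega>"
  proof
    fix x assume "x \<in> K"
    then have "x \<notin> frontier \<Omega>" "x \<in> closure \<Omega>" using u0 \<epsilon> by (auto simp: K_def)
    then show "x \<in> \<Omega>" using \<Omega> by (simp add: frontier_def interior_open)
  qed
  have "continuous_on K (\<lambda>x. cmod (G (cx x)))"
    by (intro continuous_intros continuous_on_compose2[OF holomorphic_on_imp_continuous_on[OF G]])
      (use K\<Omega> in auto)
  then obtain r0 where r0: "r0 < 1" "\<And>x. x \<in> K \<Longrightarrow> cmod (G (cx x)) \<le> r0"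
  proof (cases "K = {}")
    case True then show ?thesis using that[of 0] by simp
  next
    case False
    assume c: "continuous_on K (\<lambda>x. cmod (G (cx x)))"
    obtain y where y: "y \<in> K" "\<And>x. x \<in> K \<Longrightarrow> cmod (G (cx x)) \<le> cmod (G (cx y))"
      using continuous_attains_sup[OF K False c] by blast
    have "cmod (G (cx y)) < 1" using FG[of "cx y"] y(1) K\<Omega> by auto
    then show ?thesis using that y by blast
  qed
  define r where "r = (1 + max r0 0) / 2"
  have r: "0 < r" "r < 1" "r0 < r" using r0 by (auto simp: r_def)
  have sub: "cball 0 r \<subseteq> ball (0::complex) 1" using r by auto
  define P where "P N w = (\<Sum>n\<le>N. (if n = 0 then 0 else taylor_coeff F n) * w ^ n)" for N and w :: complex
  obtain N where N: "\<And>w. w \<in> cball 0 r \<Longrightarrow> (cmod (F w - F 0))\<^sup>2 \<le> (cmod (P N w))\<^sup>2 + \<epsilon>"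
  proof -
    have "continuous_on (cball 0 r) F"
      using holomorphic_on_imp_continuous_on[OF F] sub continuous_on_subset by blast
    then have "continuous_on (cball 0 r) (\<lambda>w. F w - F 0)" by (intro continuous_intros)
    then have "bounded ((\<lambda>w. F w - F 0) ` cball 0 r)"
      by (intro compact_imp_bounded compact_continuous_image) auto
    then obtain C where C: "C > 0" "\<And>w. w \<in> cball 0 r \<Longrightarrow> cmod (F w - F 0) \<le> C"
      unfolding bounded_pos by (metis image_eqI)
    define \<delta> where "\<delta> = \<epsilon> / (2 * C)"
    have \<delta>: "\<delta> > 0" using \<epsilon> C by (simp add: \<delta>_def)
    obtain M where M: "\<And>n w. n \<ge> M \<Longrightarrow> w \<in> cball 0 r \<Longrightarrow> dist (\<Sum>n<n. taylor_coeff F n * w ^ n) (F w) < \<delta>"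
      using uniform_limitD[OF uniform_limit_taylor[OF F r(2)] \<delta>] unfolding eventually_sequentially by blast
    have "(cmod (F w - F 0))\<^sup>2 \<le> (cmod (P M w))\<^sup>2 + \<epsilon>" if w: "w \<in> cball 0 r" for w
    proof -
      have "P M w = (\<Sum>n<Suc M. taylor_coeff F n * w ^ n) - F 0"
        unfolding P_def lessThan_Suc_atMost
        by (subst (1 2) sum.atMost_shift) (simp add: taylor_coeff_def)
      then have "(F w - F 0) - P M w = F w - (\<Sum>n<Suc M. taylor_coeff F n * w ^ n)"
        by simp
      then have "cmod ((F w - F 0) - P M w) < \<delta>"
        using M[of "Suc M" w] w by (simp only: dist_norm norm_minus_commute)
      then have le: "cmod (F w - F 0) - cmod (P M w) \<le> \<delta>"
        using norm_triangle_ineq2[of "F w - F 0" "P M w"] by linarith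
      have "(cmod (F w - F 0))\<^sup>2 - (cmod (P M w))\<^sup>2 \<le> 2 * C * \<delta>"
      proof (cases "cmod (F w - F 0) \<le> cmod (P M w)")
        case True
        then have "(cmod (F w - F 0))\<^sup>2 \<le> (cmod (P M w))\<^sup>2" by (intro power_mono) auto
        moreover have "0 \<le> 2 * C * \<delta>" using C \<delta> by simp
        ultimately show ?thesis by linarith
      next
        case False
        have "(cmod (F w - F 0))\<^sup>2 - (cmod (P M w))\<^sup>2 = (cmod (F w - F 0) + cmod (P M w)) * (cmod (F w - F 0) - cmod (P M w))"
          by (simp add: power2_eq_square algebra_simps)
        also have "\<dots> \<le> (2 * C) * \<delta>"
          using False C(1) C(2)[OF w] le by (intro mult_mono) auto
        finally show ?thesis .
      qed
      then show ?thesis using C \<epsilon> by (simp add: \<delta>_def)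
    qed
    then show ?thesis using that by blast
  qed
  obtain Q where Q: "Q holomorphic_on UNIV"
    "\<And>w. cmod w = r \<Longrightarrow> Re (Q w) = (cmod (P N w))\<^sup>2"
    "Re (Q 0) = (\<Sum>n\<le>N. (cmod (if n = 0 then 0 else taylor_coeff F n))\<^sup>2 * r ^ (2 * n))"
    using norm_square_on_circle_eq_Re_entire[OF r(1), where N = N and b = "\<lambda>n. if n = 0 then 0 else taylor_coeff F n"]
    by (auto simp: P_def)
  have injF: "inj_on F (ball 0 1)" using GF by (metis inj_onI)
  define V where "V = rv ` F ` ball 0 r"
  have ballr: "ball 0 r \<subseteq> ball (0::complex) 1" using r by auto
  have openF: "open (F ` ball 0 r)"
    by (rule open_mapping_thm3[OF holomorphic_on_subset[OF F ballr] _ inj_on_subset[OF injF ballr]]) auto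
  have "V \<subseteq> rv ` cx ` \<Omega>" unfolding V_def using GF ballr by blast
  then have V\<Omega>: "V \<subseteq> \<Omega>" by (simp add: image_image)
  have V: "open V" "bounded V"
    using openF open_rv_image V\<Omega> \<Omega> bounded_subset by (auto simp: V_def)
  have cV: "closure V \<subseteq> rv ` F ` cball 0 r"
  proof (rule closure_minimal)
    show "V \<subseteq> rv ` F ` cball 0 r" unfolding V_def by (intro image_mono) auto
    have "compact (rv ` F ` cball 0 r)"
      by (intro compact_continuous_image continuous_on_rv continuous_on_id holomorphic_on_imp_continuous_on
          holomorphic_on_subset[OF F sub]) auto
    then show "closed (rv ` F ` cball 0 r)" by (rule compact_imp_closed)
  qed
  have cV\<Omega>: "closure V \<subseteq> \<Omega>"
  proof -
    have "rv ` F ` cball 0 r \<subseteq> rv ` cx ` \<Omega>" using GF sub by blast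
    then show ?thesis using cV by (auto simp: image_image)
  qed
  define v where "v x = u x + ((1/4) * (norm (x - p))\<^sup>2 + (- 1/4) * Re (Q (G (cx x))))" for x
  have QG: "(\<lambda>z. Q (G z)) holomorphic_on cx ` \<Omega>"
    using holomorphic_on_compose_gen[OF G Q(1)] by (simp add: o_def)
  have "u p + ((1/4) * (norm (p - p))\<^sup>2 + (- 1/4) * Re (Q (G (cx p)))) = v p" by (simp add: v_def)
  \<comment> \<open>One \<open>\<epsilon>\<close> bounds \<open>u\<close> on the image of the
    circle, and \<open>\<epsilon> / 4\<close> is the Taylor error divided by 4.\<close>
  also have "v p \<le> \<epsilon> + \<epsilon> / 4"
  proof (rule weak_maximum_principle[OF V])
    have "continuous_on (closure V) (\<lambda>x. Q (G (cx x)))"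
      by (rule continuous_on_compose2[OF holomorphic_on_imp_continuous_on[OF QG]])
        (use cV\<Omega> in \<open>auto intro!: continuous_intros\<close>)
    moreover have "continuous_on (closure V) u"
      using ucont cV\<Omega> closure_subset by (blast intro: continuous_on_subset)
    ultimately show "continuous_on (closure V) v"
      unfolding v_def by (intro continuous_intros)
  next
    fix x assume "x \<in> V"
    then have x: "x \<in> \<Omega>" using V\<Omega> by blast
    let ?D = "deriv (deriv (\<lambda>z. Q (G z))) (cx x)"
    have d: "second_dir_deriv v x (axis i 1) (second_partial u i i x + ((1/4) * (2 * (norm (axis i 1 :: real^2))\<^sup>2) + (-1/4) * Re (?D * (cx (axis i 1))\<^sup>2)))" for i
      unfolding v_def
      by (intro second_dir_deriv_add second_dir_deriv_cmult second_dir_deriv_dist_square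
        torsion_function_second_dir_deriv[OF tors \<Omega>(1) x] second_dir_deriv_Re_holomorphic[OF QG open_cx_image[OF \<Omega>(1)]])
       (use x in auto)
    show "subharmonic_at v x"
      unfolding subharmonic_at_def using d[of 1] d[of 2] torsion_function_laplacian[OF tors x]
      by (intro exI conjI) (assumption, assumption, simp add: norm_axis_1)
  next
    fix x assume "x \<in> frontier V"
    then have "x \<in> closure V" "x \<notin> V" using V by (auto simp: frontier_def interior_open)
    then obtain w where w: "w \<in> cball 0 r" "x = rv (F w)" "w \<notin> ball 0 r"
      using cV unfolding V_def by blast
    then have wr: "cmod w = r" by simp
    have Gx: "G (cx x) = w" using w GF sub by auto
    have x\<Omega>: "x \<in> \<Omega>" using \<open>x \<in> closure V\<close> cV\<Omega> by blast
    have "x \<notin> K" using r0(2)[of x] Gx wr r by auto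
    then have "u x \<le> \<epsilon>" using x\<Omega> closure_subset[of \<Omega>] by (auto simp: K_def)
    moreover have "norm (x - p) = cmod (F w - F 0)"
      using w p by (metis cx_diff cx_rv norm_cx)
    then have "(norm (x - p))\<^sup>2 \<le> Re (Q w) + \<epsilon>" using N[OF w(1)] Q(2)[OF wr] by simp
    ultimately show "v x \<le> \<epsilon> + \<epsilon> / 4" unfolding v_def Gx by simp
  next
    have "F 0 \<in> F ` ball 0 r" using r by simp
    then show "p \<in> V" unfolding V_def p by (metis image_eqI rv_cx)
  qed
  finally have "u p \<le> \<epsilon> + \<epsilon> / 4 + Re (Q (G (cx p))) / 4" by simp
  moreover have "G (cx p) = 0" using GF[of 0] p by simp
  moreover have "Re (Q 0) \<le> S"
  proof -
    have "Re (Q 0) = (\<Sum>n=1..N. (cmod (taylor_coeff F n))\<^sup>2 * r ^ (2 * n))"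
      unfolding Q(3) by (rule sum.mono_neutral_cong_right) auto
    also have "\<dots> \<le> (\<Sum>n=1..N. (cmod (taylor_coeff F n))\<^sup>2)"
      using r by (intro sum_mono mult_left_le power_le_one) auto
    finally show ?thesis using S order_trans by blast
  qed
  ultimately show "u p \<le> S / 4 + \<epsilon>'" using \<open>\<epsilon>' > 0\<close> by (simp add: \<epsilon>_def)
qed

lemma Riemann_map_at:
  assumes dom: "bounded_convex_domain \<Omega>" and p: "p \<in> \<Omega>"
  obtains F G where "F holomorphic_on ball 0 1" "G holomorphic_on cx ` \<Omega>"
    "\<And>z. z \<in> cx ` \<Omega> \<Longrightarrow> G z \<in> ball 0 1 \<and> F (G z) = z"
    "\<And>w. w \<in> ball 0 1 \<Longrightarrow> F w \<in> cx ` \<Omega> \<and> G (F w) = w" "F 0 = cx p"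
proof -
  let ?S = "cx ` \<Omega>"
  have S: "open ?S" using dom open_cx_image by (auto simp: bounded_convex_domain_def)
  have "convex ?S" using dom convex_linear_image[OF linear_cx] by (auto simp: bounded_convex_domain_def)
  then have sc: "simply_connected ?S" by (rule convex_imp_simply_connected)
  have "bounded ?S"
    using dom bounded_linear_image[OF _ bounded_linear_cx] by (auto simp: bounded_convex_domain_def)
  then have "?S \<noteq> UNIV" by (metis not_bounded_UNIV)
  moreover have "?S \<noteq> {}" using p by blast
  ultimately obtain f g where f: "f holomorphic_on ?S" and g: "g holomorphic_on ball 0 1"
    and fg: "\<And>z. z \<in> ?S \<Longrightarrow> f z \<in> ball 0 1 \<and> g (f z) = z"
    and gf: "\<And>z. z \<in> ball 0 1 \<Longrightarrow> g z \<in> ?S \<and> f (g z) = z"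
    using Riemann_mapping_theorem[of ?S] S sc by blast
  have pS: "cx p \<in> ?S" using p by blast
  obtain h k where hk: "h (f (cx p)) = 0"
    "h holomorphic_on ball 0 1" "h ` ball 0 1 \<subseteq> ball 0 1"
    "k holomorphic_on ball 0 1" "k ` ball 0 1 \<subseteq> ball 0 1"
    "\<And>z. z \<in> ball 0 1 \<Longrightarrow> h (k z) = z" "\<And>z. z \<in> ball 0 1 \<Longrightarrow> k (h z) = z"
    using ball_biholomorphism_exists[of "f (cx p)"] fg[OF pS] by metis
  show thesis
  proof
    show "g \<circ> k holomorphic_on ball 0 1"
      by (rule holomorphic_on_compose_gen[OF hk(4) g hk(5)])
    show "h \<circ> f holomorphic_on ?S"
      by (rule holomorphic_on_compose_gen[OF f hk(2)]) (use fg in blast)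
    show "(h \<circ> f) z \<in> ball 0 1 \<and> (g \<circ> k) ((h \<circ> f) z) = z" if "z \<in> ?S" for z
      using fg[OF that] hk(3,7) by (metis comp_apply image_subset_iff)
    show "(g \<circ> k) w \<in> ?S \<and> (h \<circ> f) ((g \<circ> k) w) = w" if "w \<in> ball 0 1" for w
      using that gf[of "k w"] hk(5,6) by (metis comp_apply image_subset_iff)
    have "k 0 = f (cx p)" using hk(1) hk(7)[of "f (cx p)"] fg[OF pS] by metis
    then show "(g \<circ> k) 0 = cx p" using fg[OF pS] by simp
  qed
qed

section \<open>The gradient bound\<close>

lemma bounded_convex_domain_lmeasurable:
  assumes "bounded_convex_domain \<Omega>"
  shows "\<Omega> \<in> lmeasurable" "measure lebesgue \<Omega> > 0"
proof -
  show l: "\<Omega> \<in> lmeasurable" using assms by (auto simp: bounded_convex_domain_def intro: lmeasurable_open)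
  have "\<not> negligible \<Omega>" using assms open_not_negligible by (auto simp: bounded_convex_domain_def)
  then have "measure lebesgue \<Omega> \<noteq> 0" using l negligible_iff_measure by blast
  then show "measure lebesgue \<Omega> > 0" by (simp add: zero_less_measure_iff)
qed

lemma torsion_nonneg:
  assumes dom: "bounded_convex_domain \<Omega>" and tors: "torsion_function \<Omega> u" and x: "x \<in> closure \<Omega>"
  shows "0 \<le> u x"
proof (cases "x \<in> \<Omega>")
  case True
  have \<Omega>: "open \<Omega>" "bounded \<Omega>" using dom by (auto simp: bounded_convex_domain_def)
  have "(-1) * u x \<le> 0"
  proof (rule weak_maximum_principle[OF \<Omega> _ _ _ True])
    show "continuous_on (closure \<Omega>) (\<lambda>x. (-1) * u x)"
      using tors by (intro continuous_intros) (auto simp: torsion_function_def)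
    show "subharmonic_at (\<lambda>x. (-1) * u x) y" if "y \<in> \<Omega>" for y
      unfolding subharmonic_at_def
      using second_dir_deriv_cmult[OF torsion_function_second_dir_deriv[OF tors \<Omega>(1) that], of "-1"]
        torsion_function_laplacian[OF tors that]
      by (intro exI conjI) (assumption, assumption, simp)
  qed (use tors in \<open>auto simp: torsion_function_def\<close>)
  then show ?thesis by simp
next
  case False
  then have "x \<in> frontier \<Omega>" using x dom by (simp add: bounded_convex_domain_def frontier_def interior_open)
  then show ?thesis using tors by (auto simp: torsion_function_def)
qed

text \<open>The area bounds \<open>\<Sum> n |a n|^2\<close> by \<open>8 * t^2\<close>. In
  \<open>\<Sum> |a n|^2\<close> every term with \<open>n >= 2\<close> costs at most half of its
  share, and the half of \<open>|a 1|^2\<close> that is left over is controlled by the half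
  plane.\<close>

lemma torsion_le_at_depth:
  assumes dom: "bounded_convex_domain \<Omega>" and tors: "torsion_function \<Omega> u" and p: "p \<in> \<Omega>"
    and \<nu>: "norm \<nu> = 1" and half: "\<And>x. x \<in> \<Omega> \<Longrightarrow> \<beta> < \<nu> \<bullet> x" and t: "t = \<nu> \<bullet> p - \<beta>"
    and area: "measure lebesgue \<Omega> = 8 * pi * t\<^sup>2"
  shows "u p \<le> 11.61 / 8 * t\<^sup>2"
proof -
  have t0: "t > 0" using half[OF p] t by simp
  obtain F G where F: "F holomorphic_on ball 0 1" and G: "G holomorphic_on cx ` \<Omega>"
    and FG: "\<And>z. z \<in> cx ` \<Omega> \<Longrightarrow> G z \<in> ball 0 1 \<and> F (G z) = z"
    and GF: "\<And>w. w \<in> ball 0 1 \<Longrightarrow> F w \<in> cx ` \<Omega> \<and> G (F w) = w" and F0: "F 0 = cx p"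
    using Riemann_map_at[OF dom p] by blast
  define a where "a = taylor_coeff F"
  have area_ge: "(\<Sum>n\<le>N. real n * (cmod (a n))\<^sup>2) \<le> 8 * t\<^sup>2" for N
  proof -
    have "inj_on F (ball 0 1)" using GF by (metis inj_onI)
    moreover have "F ` ball 0 1 \<subseteq> cx ` \<Omega>" using GF by blast
    then have "rv ` F ` ball 0 1 \<subseteq> \<Omega>" by auto
    ultimately have "pi * (\<Sum>n\<le>N. real n * (cmod (a n))\<^sup>2) \<le> pi * (8 * t\<^sup>2)"
      unfolding a_def using area_ge_taylor_coeffs[OF F _ _ bounded_convex_domain_lmeasurable(1)[OF dom]] area
      by (simp add: mult_ac)
    then show ?thesis by simp
  qed
  \<comment> \<open>With this factor \<open>Re (k w)\<close> is the depth of \<open>F w\<close>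
    divided by \<open>t\<close>, hence positive, and \<open>k 0 = 1\<close>.\<close>
  define c where "c = cnj (cx \<nu>) / t"
  define k where "k w = c * F w + (1 - c * cx p)" for w
  have "k holomorphic_on ball 0 1" unfolding k_def by (intro holomorphic_intros F)
  moreover have "Re (k w) > 0" if w: "w \<in> ball 0 1" for w
  proof -
    obtain x where x: "x \<in> \<Omega>" "F w = cx x" using GF[OF w] by blast
    have "Re (k w) = (\<nu> \<bullet> x - \<nu> \<bullet> p) / t + 1"
      unfolding k_def c_def x(2) inner_eq_Re_cx by (simp add: field_simps diff_divide_distrib add_divide_distrib)
    also have "\<dots> = (\<nu> \<bullet> x - \<beta>) / t" using t0 t by (simp add: field_simps)
    finally show ?thesis using half[OF x(1)] t0 by simp
  qed
  ultimately have "4 * cmod (deriv k 0) - 6 * Re (k 0) \<le> cmod (deriv (deriv k) 0) / 2"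
    by (rule positive_real_part_coeff)
  moreover have k0: "k 0 = 1" by (simp add: k_def F0)
  moreover have dk: "deriv k w = c * deriv F w" if "w \<in> ball 0 1" for w
    unfolding k_def using holomorphic_derivI[OF F open_ball that]
    by (intro DERIV_imp_deriv) (auto intro!: derivative_eq_intros)
  have "deriv F holomorphic_on ball 0 1" using F holomorphic_deriv by blast
  then have "((\<lambda>w. c * deriv F w) has_field_derivative c * deriv (deriv F) 0) (at 0)"
    by (intro DERIV_cmult) (auto intro: holomorphic_derivI)
  then have "(deriv k has_field_derivative c * deriv (deriv F) 0) (at 0)"
    by (rule has_field_derivative_transform_within_open[of _ _ _ "ball 0 1"]) (use dk in auto)
  then have "deriv (deriv k) 0 = c * deriv (deriv F) 0" by (rule DERIV_imp_deriv)
  moreover have "cmod c = 1 / t" using \<nu> t0 by (simp add: c_def norm_divide)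
  moreover have "deriv F 0 = a 1" "deriv (deriv F) 0 = 2 * a 2" by (simp_all add: a_def taylor_coeff_def numeral_2_eq_2)
  ultimately have "4 * (cmod (a 1) / t) - 6 \<le> cmod (a 2) / t"
    using dk[of 0] by (simp add: norm_mult)
  from mult_right_mono[OF this, of t] have a2: "4 * cmod (a 1) - 6 * t \<le> cmod (a 2)"
    using t0 by (simp add: left_diff_distrib)
  have a12: "(cmod (a 1))\<^sup>2 + 2 * (cmod (a 2))\<^sup>2 \<le> 8 * t\<^sup>2"
    using area_ge[of 2] by (simp add: numeral_2_eq_2)
  \<comment> \<open>Beyond 1.9 the coefficient inequality gives
    \<open>|a 2| > (4 * 1.9 - 6) * t = 1.6 * t\<close>, and \<open>1.9^2 + 2 * 1.6^2 = 8.73\<close>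
    exceeds the 8 that the area permits.\<close>
  have "cmod (a 1) \<le> 1.9 * t"
  proof (rule ccontr)
    assume "\<not> cmod (a 1) \<le> 1.9 * t"
    then have "1.9 * t < cmod (a 1)" "1.6 * t < cmod (a 2)" using a2 by auto
    then have "(1.9 * t)\<^sup>2 < (cmod (a 1))\<^sup>2" "(1.6 * t)\<^sup>2 < (cmod (a 2))\<^sup>2"
      using t0 by (intro power_strict_mono; simp)+
    moreover have "0 < t\<^sup>2" using t0 by simp
    ultimately show False using a12 by (simp add: power_mult_distrib power2_eq_square)
  qed
  then have a1: "(cmod (a 1))\<^sup>2 \<le> 3.61 * t\<^sup>2"
    using power_mono[of "cmod (a 1)" "1.9 * t" 2] by (simp add: power_mult_distrib power2_eq_square)
  \<comment> \<open>Here \<open>11.61 = 8 + 1.9^2\<close>.\<close>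
  have "(\<Sum>n=1..N. (cmod (a n))\<^sup>2) \<le> 11.61 / 2 * t\<^sup>2" for N
  proof -
    have "(\<Sum>n=1..N. (cmod (a n))\<^sup>2) \<le> (\<Sum>n=1..N. 1 / 2 * (real n * (cmod (a n))\<^sup>2) + (if n = 1 then 1 / 2 * (cmod (a 1))\<^sup>2 else 0))"
    proof (rule sum_mono)
      fix n assume n: "n \<in> {1..N}"
      show "(cmod (a n))\<^sup>2 \<le> 1 / 2 * (real n * (cmod (a n))\<^sup>2) + (if n = 1 then 1 / 2 * (cmod (a 1))\<^sup>2 else 0)"
      proof (cases "n = 1")
        case False
        then have "2 * (cmod (a n))\<^sup>2 \<le> real n * (cmod (a n))\<^sup>2" using n by (intro mult_right_mono) auto
        then show ?thesis using False by simp
      qed simp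
    qed
    also have "\<dots> \<le> 1 / 2 * (\<Sum>n=1..N. real n * (cmod (a n))\<^sup>2) + 1 / 2 * (cmod (a 1))\<^sup>2"
      by (simp add: sum.distrib sum_distrib_left sum.delta)
    also have "(\<Sum>n=1..N. real n * (cmod (a n))\<^sup>2) = (\<Sum>n\<le>N. real n * (cmod (a n))\<^sup>2)"
      by (rule sum.mono_neutral_left) auto
    finally show ?thesis using area_ge[of N] a1 by simp
  qed
  then have "u p \<le> (11.61 / 2 * t\<^sup>2) / 4"
    using torsion_le_taylor_coeffs[OF dom tors F G FG GF F0] unfolding a_def by blast
  then show ?thesis by simp
qed

text \<open>In terms of the depth \<open>s\<close> the barrier is
  \<open>1.95125 * t * s - s^2 / 2\<close>, which has Laplacian -1. It is nonnegative for
  \<open>0 <= s <= t\<close>, which settles the boundary of \<open>\<Omega>\<close>, and at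
  \<open>s = t\<close> it equals \<open>11.61 / 8 * t^2\<close>, exactly the bound known at that
  depth.\<close>

lemma torsion_le_depth:
  assumes dom: "bounded_convex_domain \<Omega>" and tors: "torsion_function \<Omega> u" and p: "p \<in> \<Omega>"
    and \<nu>: "norm \<nu> = 1" and half: "\<And>x. x \<in> \<Omega> \<Longrightarrow> \<beta> < \<nu> \<bullet> x"
    and t: "t > 0" and area: "measure lebesgue \<Omega> = 8 * pi * t\<^sup>2" and pt: "\<nu> \<bullet> p - \<beta> \<le> t"
  shows "u p \<le> 1.95125 * t * (\<nu> \<bullet> p - \<beta>)"
proof -
  have \<Omega>: "open \<Omega>" "bounded \<Omega>" using dom by (auto simp: bounded_convex_domain_def)
  have depth: "u x \<le> 11.61 / 8 * t\<^sup>2" if "x \<in> \<Omega>" "\<nu> \<bullet> x - \<beta> = t" for x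
    using torsion_le_at_depth[OF dom tors that(1) \<nu> half that(2)[symmetric] area] .
  show ?thesis
  proof (cases "\<nu> \<bullet> p - \<beta> = t")
    case True
    have "11.61 / 8 * t\<^sup>2 \<le> 1.95125 * t * t" using t by (simp add: power2_eq_square)
    then show ?thesis using depth[OF p True] True by simp
  next
    case False
    define V where "V = \<Omega> \<inter> {x. \<nu> \<bullet> x < \<beta> + t}"
    have V: "open V" "bounded V"
      unfolding V_def using \<Omega> by (auto intro!: open_Int open_halfspace_lt bounded_Int)
    have pV: "p \<in> V" using p pt False by (simp add: V_def)
    have cl: "x \<in> closure \<Omega> \<and> \<beta> \<le> \<nu> \<bullet> x \<and> \<nu> \<bullet> x \<le> \<beta> + t" if "x \<in> closure V" for x
    proof -
      have "closure V \<subseteq> {x. \<beta> \<le> \<nu> \<bullet> x} \<inter> {x. \<nu> \<bullet> x \<le> \<beta> + t}"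
        by (rule closure_minimal) (use half in \<open>auto simp: V_def less_imp_le intro!: closed_Int closed_halfspace_le closed_halfspace_ge\<close>)
      moreover have "closure V \<subseteq> closure \<Omega>" by (intro closure_mono) (auto simp: V_def)
      ultimately show ?thesis using that by blast
    qed
    define v where "v x = u x + ((- (1.95125 * t)) * (\<nu> \<bullet> x + - \<beta>) + (1 / 2) * (\<nu> \<bullet> x + - \<beta>)\<^sup>2)" for x
    have "v p \<le> 0"
    proof (rule weak_maximum_principle[OF V _ _ _ pV])
      have "continuous_on (closure V) u"
        using tors cl by (auto simp: torsion_function_def intro: continuous_on_subset)
      then show "continuous_on (closure V) v" unfolding v_def by (intro continuous_intros)
    next
      fix x assume "x \<in> V"
      then have x: "x \<in> \<Omega>" by (simp add: V_def)
      have "second_dir_deriv v x (axis i 1) (second_partial u i i x + ((- (1.95125 * t)) * 0 + (1 / 2) * (2 * (\<nu> \<bullet> axis i 1)\<^sup>2)))" for i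
        unfolding v_def
        by (intro second_dir_deriv_add second_dir_deriv_cmult second_dir_deriv_inner second_dir_deriv_inner_square
          torsion_function_second_dir_deriv[OF tors \<Omega>(1) x])
      note d = this
      have "(\<nu> \<bullet> axis 1 1)\<^sup>2 + (\<nu> \<bullet> axis 2 1)\<^sup>2 = (norm \<nu>)\<^sup>2"
        by (simp add: norm_vec_def L2_set_def sum_2 inner_axis)
      then show "subharmonic_at v x"
        unfolding subharmonic_at_def using d[of 1] d[of 2] torsion_function_laplacian[OF tors x] \<nu>
        by (intro exI conjI) (assumption, assumption, simp)
    next
      fix x assume "x \<in> frontier V"
      then have "x \<in> closure V" "x \<notin> V" using V by (auto simp: frontier_def interior_open)
      define s where "s = \<nu> \<bullet> x - \<beta>"
      have s: "0 \<le> s" "s \<le> t" using cl[OF \<open>x \<in> closure V\<close>] by (auto simp: s_def)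
      have vx: "v x = u x - 1.95125 * t * s + s * s / 2" by (simp add: v_def s_def power2_eq_square)
      show "v x \<le> 0"
      proof (cases "x \<in> \<Omega>")
        case True
        then have "s = t" using \<open>x \<notin> V\<close> s by (simp add: V_def s_def)
        then show ?thesis using depth[OF True] vx by (simp add: s_def power2_eq_square)
      next
        case False
        then have "x \<in> frontier \<Omega>" using cl[OF \<open>x \<in> closure V\<close>] \<Omega> by (simp add: frontier_def interior_open)
        then have "u x = 0" using tors by (simp add: torsion_function_def)
        moreover have "s * s \<le> t * s" using s by (intro mult_right_mono)
        moreover have "0 \<le> t * s" using s t by simp
        ultimately show ?thesis using vx by simp
      qed
    qed
    then have "u p \<le> 1.95125 * t * (\<nu> \<bullet> p - \<beta>) - (\<nu> \<bullet> p - \<beta>)\<^sup>2 / 2" by (simp add: v_def)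
    then show ?thesis using zero_le_power2[of "\<nu> \<bullet> p - \<beta>"] by linarith
  qed
qed

lemma supporting_halfplane:
  fixes \<Omega> :: "(real^2) set"
  assumes dom: "bounded_convex_domain \<Omega>" and y: "y \<in> frontier \<Omega>"
  obtains \<nu> where "norm \<nu> = 1" "\<And>x. x \<in> \<Omega> \<Longrightarrow> \<nu> \<bullet> y < \<nu> \<bullet> x"
proof -
  have \<Omega>: "open \<Omega>" "convex \<Omega>" using dom by (auto simp: bounded_convex_domain_def)
  have rel: "rel_interior \<Omega> = \<Omega>" using \<Omega> by (simp add: rel_interior_open)
  have "y \<in> closure \<Omega>" "y \<notin> rel_interior \<Omega>" using y \<Omega> unfolding rel by (auto simp: frontier_def interior_open)
  then obtain a where a: "a \<noteq> 0" "\<And>x. x \<in> rel_interior \<Omega> \<Longrightarrow> a \<bullet> y < a \<bullet> x"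
    using supporting_hyperplane_relative_frontier[OF \<Omega>(2)] by metis
  show thesis
  proof
    show "norm (a /\<^sub>R norm a) = 1" using a by simp
    show "(a /\<^sub>R norm a) \<bullet> y < (a /\<^sub>R norm a) \<bullet> x" if "x \<in> \<Omega>" for x
      using a that unfolding rel by (simp add: divide_strict_right_mono inverse_eq_divide)
  qed
qed

text \<open>The increment is harmonic where both \<open>y\<close> and \<open>y + h\<close> lie in
  \<open>\<Omega>\<close>, so only the frontier of that set matters. If \<open>y + h\<close> has
  left \<open>\<Omega>\<close>, then \<open>u (y + h) = 0 <= u y\<close>. Otherwise
  \<open>u y = 0\<close>, and \<open>y + h\<close> has depth at most \<open>norm h <= t\<close>
  below a supporting line at \<open>y\<close>, so the strip estimate applies.\<close>

lemma torsion_increment_le: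
  assumes dom: "bounded_convex_domain \<Omega>" and tors: "torsion_function \<Omega> u"
    and x: "x \<in> \<Omega>" "x + h \<in> \<Omega>"
    and t: "t > 0" and area: "measure lebesgue \<Omega> = 8 * pi * t\<^sup>2" and h: "norm h \<le> t"
  shows "u (x + h) - u x \<le> 1.95125 * t * norm h"
proof -
  have \<Omega>: "open \<Omega>" "bounded \<Omega>" using dom by (auto simp: bounded_convex_domain_def)
  have ucont: "continuous_on (closure \<Omega>) u" and u0: "\<And>x. x \<in> frontier \<Omega> \<Longrightarrow> u x = 0"
    using tors by (auto simp: torsion_function_def)
  define V where "V = \<Omega> \<inter> (\<lambda>y. y + h) -` \<Omega>"
  have V: "open V" "bounded V"
    unfolding V_def using \<Omega> by (auto intro!: open_Int open_vimage continuous_intros bounded_Int)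
  have cl: "y \<in> closure \<Omega>" "y + h \<in> closure \<Omega>" if "y \<in> closure V" for y
  proof -
    have "closure V \<subseteq> closure \<Omega>" by (intro closure_mono) (auto simp: V_def)
    then show "y \<in> closure \<Omega>" using that by blast
    have "(\<lambda>y. y + h) ` closure V \<subseteq> closure \<Omega>"
      by (rule image_closure_subset) (use closure_subset[of \<Omega>] in \<open>auto simp: V_def intro!: continuous_intros\<close>)
    then show "y + h \<in> closure \<Omega>" using that by blast
  qed
  have "u (x + h) + (-1) * u x \<le> 1.95125 * t * norm h"
  proof (rule weak_maximum_principle[OF V, where v = "\<lambda>y. u (y + h) + (-1) * u y"])
    have "continuous_on (closure V) u" using ucont cl by (meson continuous_on_subset subsetI)
    moreover have "continuous_on (closure V) (\<lambda>y. u (y + h))"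
      by (rule continuous_on_compose2[OF ucont]) (use cl in \<open>auto intro!: continuous_intros\<close>)
    ultimately show "continuous_on (closure V) (\<lambda>y. u (y + h) + (-1) * u y)" by (intro continuous_intros)
  next
    fix y assume "y \<in> V"
    then have y: "y \<in> \<Omega>" "y + h \<in> \<Omega>" by (auto simp: V_def)
    have "second_dir_deriv (\<lambda>y. u (y + h) + (-1) * u y) y (axis i 1) (second_partial u i i (y + h) + (-1) * second_partial u i i y)" for i
      by (intro second_dir_deriv_add second_dir_deriv_cmult second_dir_deriv_translate
          torsion_function_second_dir_deriv[OF tors \<Omega>(1)] y)
    note d = this
    show "subharmonic_at (\<lambda>y. u (y + h) + (-1) * u y) y"
      unfolding subharmonic_at_def
      using d[of 1] d[of 2] torsion_function_laplacian[OF tors y(1)] torsion_function_laplacian[OF tors y(2)]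
      by (intro exI conjI) (assumption, assumption, simp)
  next
    fix y assume "y \<in> frontier V"
    then have y: "y \<in> closure V" "y \<notin> V" using V by (auto simp: frontier_def interior_open)
    note c = cl[OF y(1)]
    have L: "0 \<le> 1.95125 * t * norm h" using t by simp
    show "u (y + h) + (-1) * u y \<le> 1.95125 * t * norm h"
    proof (cases "y + h \<in> \<Omega>")
      case False
      then have "y + h \<in> frontier \<Omega>" using c \<Omega> by (simp add: frontier_def interior_open)
      then show ?thesis using u0 torsion_nonneg[OF dom tors c(1)] L by simp
    next
      case True
      then have "y \<in> frontier \<Omega>" using c \<Omega> y by (simp add: V_def frontier_def interior_open)
      then obtain \<nu> where \<nu>: "norm \<nu> = 1" "\<And>x. x \<in> \<Omega> \<Longrightarrow> \<nu> \<bullet> y < \<nu> \<bullet> x"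
        using supporting_halfplane[OF dom] by blast
      have s: "\<nu> \<bullet> (y + h) - \<nu> \<bullet> y \<le> norm h"
        using norm_cauchy_schwarz[of \<nu> h] \<nu> by (simp add: inner_add_right)
      then have "u (y + h) \<le> 1.95125 * t * (\<nu> \<bullet> (y + h) - \<nu> \<bullet> y)"
        using torsion_le_depth[OF dom tors True \<nu> t area] h by simp
      also have "\<dots> \<le> 1.95125 * t * norm h" using s t by (intro mult_left_mono) auto
      finally show ?thesis using u0[OF \<open>y \<in> frontier \<Omega>\<close>] by simp
    qed
  next
    show "x \<in> V" using x by (simp add: V_def)
  qed
  then show ?thesis by simp
qed

section \<open>From increments to the gradient\<close>

lemma frechet_derivative_eq_grad:
  assumes "u differentiable (at x)"
  shows "(u has_derivative (\<lambda>h. grad u x \<bullet> h)) (at x)"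
proof -
  let ?D = "frechet_derivative u (at x)"
  have D: "(u has_derivative ?D) (at x)" using assms by (simp add: frechet_derivative_works)
  then have lin: "linear ?D" by (rule has_derivative_linear)
  have "?D h = grad u x \<bullet> h" for h :: "real^2"
  proof -
    have "h = h $ 1 *\<^sub>R axis 1 1 + h $ 2 *\<^sub>R axis 2 1"
      by (simp add: vec_eq_iff forall_2 axis_def)
    then have "?D h = h $ 1 * ?D (axis 1 1) + h $ 2 * ?D (axis 2 1)"
      by (metis linear_add[OF lin] linear_cmul[OF lin] real_scaleR_def)
    then show ?thesis by (simp add: grad_def inner_vec_def sum_2 mult.commute)
  qed
  then have "?D = (\<lambda>h. grad u x \<bullet> h)" by blast
  then show ?thesis using D by simp
qed

theorem torsion_gradient_bound:
  assumes dom: "bounded_convex_domain \<Omega>" and tors: "torsion_function \<Omega> u" and x: "x \<in> \<Omega>"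
  shows "norm (grad u x) \<le> 0.975625 / sqrt (2 * pi) * sqrt (measure lebesgue \<Omega>)"
proof -
  define t where "t = sqrt (measure lebesgue \<Omega> / (8 * pi))"
  have A: "measure lebesgue \<Omega> > 0" by (rule bounded_convex_domain_lmeasurable[OF dom])
  have t: "t > 0" using A by (simp add: t_def)
  have area: "measure lebesgue \<Omega> = 8 * pi * t\<^sup>2" using A by (simp add: t_def)
  have \<Omega>: "open \<Omega>" using dom by (auto simp: bounded_convex_domain_def)
  let ?g = "grad u x"
  have "norm ?g \<le> 1.95125 * t"
  proof (cases "?g = 0")
    case True then show ?thesis using t by simp
  next
    case False
    define e where "e = ?g /\<^sub>R norm ?g"
    have e: "norm e = 1" "?g \<bullet> e = norm ?g"
      using False by (auto simp: e_def power2_norm_eq_inner[symmetric] power2_eq_square)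
    have "u differentiable (at x)" using tors x by (auto simp: torsion_function_def C2_on_def)
    then have D: "(u has_derivative (\<lambda>h. ?g \<bullet> h)) (at (x + 0 *\<^sub>R e))"
      using frechet_derivative_eq_grad by simp
    have "((\<lambda>s. x + s *\<^sub>R e) has_derivative (\<lambda>s. s *\<^sub>R e)) (at 0)"
      by (auto intro!: derivative_eq_intros)
    from has_derivative_compose[OF this D]
    have "((\<lambda>s. u (x + s *\<^sub>R e)) has_real_derivative norm ?g) (at 0)"
      unfolding has_field_derivative_def by (elim has_derivative_eq_rhs) (auto simp: e)
    then have "((\<lambda>s. (u (x + s *\<^sub>R e) - u x) / s) \<longlongrightarrow> norm ?g) (at 0)"
      unfolding has_field_derivative_iff by simp
    then have lim: "((\<lambda>s. (u (x + s *\<^sub>R e) - u x) / s) \<longlongrightarrow> norm ?g) (at_right 0)"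
      by (rule tendsto_within_subset) simp
    have "((\<lambda>s. x + s *\<^sub>R e) \<longlongrightarrow> x + 0 *\<^sub>R e) (at_right 0)" by (intro tendsto_intros)
    then have "\<forall>\<^sub>F s in at_right 0. x + s *\<^sub>R e \<in> \<Omega>"
      using topological_tendstoD[of _ "x + 0 *\<^sub>R e" _ \<Omega>] \<Omega> x by simp
    moreover have "\<forall>\<^sub>F s in at_right 0. s \<in> {0<..<t}"
      using t by (rule eventually_at_right_real)
    ultimately have "\<forall>\<^sub>F s in at_right 0. (u (x + s *\<^sub>R e) - u x) / s \<le> 1.95125 * t"
    proof eventually_elim
      case (elim s)
      then have "u (x + s *\<^sub>R e) - u x \<le> 1.95125 * t * norm (s *\<^sub>R e)"
        by (intro torsion_increment_le[OF dom tors x _ t area]) (auto simp: e)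
      then show ?case using elim by (simp add: e field_simps)
    qed
    then show ?thesis by (rule tendsto_upperbound[OF lim]) simp
  qed
  also have "t = sqrt (measure lebesgue \<Omega>) / (2 * sqrt (2 * pi))"
  proof -
    have "sqrt (8 * pi) = sqrt (4 * (2 * pi))" by simp
    also have "\<dots> = 2 * sqrt (2 * pi)" by (subst real_sqrt_mult) simp
    finally show ?thesis by (simp add: t_def real_sqrt_divide)
  qed
  finally show ?thesis by simp
qed

section \<open>Convex conformal images of the disc\<close>

text \<open>The Noshiro-Warschawski criterion: along the segment from \<open>w\<close> to
  \<open>z\<close> the function \<open>f / (z - w)\<close> has derivative \<open>deriv f\<close>, so
  its real part increases strictly and the end values differ.\<close>

lemma Re_deriv_pos_imp_inj_on:
  assumes f: "f holomorphic_on S" "open S" and T: "convex T" "T \<subseteq> S"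
    and pos: "\<And>w. w \<in> T \<Longrightarrow> Re (deriv f w) > 0"
  shows "inj_on f T"
proof (rule inj_onI, rule ccontr)
  fix z w assume zw: "z \<in> T" "w \<in> T" "f z = f w" "z \<noteq> w"
  define l where "l s = w + of_real s * (z - w)" for s
  have lT: "l s \<in> T" if "0 \<le> s" "s \<le> 1" for s
  proof -
    have "l s = (1 - s) *\<^sub>R w + s *\<^sub>R z" by (simp add: l_def scaleR_conv_of_real algebra_simps)
    then show ?thesis using convexD_alt[OF T(1) zw(2,1)] that by simp
  qed
  have der: "((\<lambda>s. Re (f (l s) / (z - w))) has_real_derivative Re (deriv f (l s))) (at s)" if "0 \<le> s" "s \<le> 1" for s
  proof -
    have "(l has_vector_derivative (z - w)) (at s)"
      unfolding l_def by (auto intro!: derivative_eq_intros)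
    moreover have "(f has_field_derivative deriv f (l s)) (at (l s))"
      using lT[OF that] T f holomorphic_derivI by blast
    ultimately have "((f \<circ> l) has_vector_derivative (z - w) * deriv f (l s)) (at s)"
      by (rule field_vector_diff_chain_at)
    note D = has_vector_derivative_mult_left[OF this, of "inverse (z - w)"]
    have "(z - w) * deriv f (l s) * inverse (z - w) = deriv f (l s)" using zw(4) by simp
    then have "((\<lambda>s. f (l s) / (z - w)) has_vector_derivative deriv f (l s)) (at s)"
      using D by (simp only: o_def divide_inverse)
    from bounded_linear.has_vector_derivative[OF bounded_linear_Re this]
    show ?thesis by (simp add: has_real_derivative_iff_has_vector_derivative)
  qed
  have "Re (f (l 0) / (z - w)) < Re (f (l 1) / (z - w))"
  proof (rule DERIV_pos_imp_increasing[of 0 1 "\<lambda>s. Re (f (l s) / (z - w))"])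
    show "\<exists>y. ((\<lambda>s. Re (f (l s) / (z - w))) has_real_derivative y) (at s) \<and> y > 0" if "0 \<le> s" "s \<le> 1" for s
      using der[OF that] pos[OF lT[OF that]] by blast
  qed simp
  then show False using zw(3) by (simp add: l_def)
qed

text \<open>The hypothesis \<open>conv\<close> is \<open>Re (1 + w f''/f') > 0\<close> on the unit circle: the tangent angle of
  the boundary curve increases. Its total increase over the circle is \<open>2 \<pi>\<close> because \<open>f'\<close> has a
  logarithm, so the curve stays on one side of each of its tangents.\<close>

lemma convex_curve_side_of_tangent:
  assumes f: "f holomorphic_on UNIV"
    and pos: "\<And>w. cmod w = 1 \<Longrightarrow> Re (deriv f w) > 0"
    and conv: "\<And>w. cmod w = 1 \<Longrightarrow> Re (cnj (deriv f w) * (deriv f w + w * deriv (deriv f) w)) > 0"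
    and w: "cmod w0 = 1" "cmod w = 1" "w \<noteq> w0"
  shows "0 < Im (cnj (\<i> * w0 * deriv f w0) * (f w - f w0))"
proof -
  define \<theta>0 where "\<theta>0 = Arg w0"
  have w0: "w0 = cis \<theta>0" using w(1) by (simp add: \<theta>0_def cis_Arg_unique complex_norm_eq_1_exp_eq cis_conv_exp)
  define \<gamma> where "\<gamma> \<theta> = f (cis \<theta>)" for \<theta>
  \<comment> \<open>\<open>\<psi> + pi / 2\<close> is the tangent angle of \<open>\<gamma>\<close>.
    Positivity of \<open>Re (deriv f)\<close> keeps \<open>deriv f\<close> off the branch cut of
    \<open>Ln\<close>, so the second summand is smooth and periodic, and \<open>\<psi>\<close> gains
    exactly \<open>2 * pi\<close> per turn.\<close>
  define \<psi> where "\<psi> \<theta> = \<theta> + Im (Ln (deriv f (cis \<theta>)))" for \<theta>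
  \<comment> \<open>Signed distance of \<open>\<gamma> \<theta>\<close> from the tangent at
    \<open>w0\<close>, scaled by \<open>cmod (deriv f w0)\<close>.\<close>
  define D where "D \<theta> = Im (cnj (\<i> * w0 * deriv f w0) * (\<gamma> \<theta> - \<gamma> \<theta>0))" for \<theta>
  have fd: "(f has_field_derivative deriv f z) (at z)" for z
    using f holomorphic_derivI by blast
  have "deriv f holomorphic_on UNIV" using f holomorphic_deriv by blast
  then have fdd: "(deriv f has_field_derivative deriv (deriv f) z) (at z)" for z
    using holomorphic_derivI by blast
  have nz: "deriv f (cis \<theta>) \<noteq> 0" for \<theta> using pos[of "cis \<theta>"] by auto
  have cisd: "(cis has_vector_derivative \<i> * cis \<theta>) (at \<theta>)" for \<theta>
    by (rule has_vector_derivative_real_field[of "\<lambda>z. exp (\<i> * z)", unfolded cis_conv_exp[symmetric]])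
      (auto intro!: derivative_eq_intros simp: cis_conv_exp)
  have \<gamma>d: "(\<gamma> has_vector_derivative \<i> * cis \<theta> * deriv f (cis \<theta>)) (at \<theta>)" for \<theta>
    using field_vector_diff_chain_at[OF cisd fd] by (simp add: \<gamma>_def[abs_def] o_def)
  have polar: "\<i> * cis \<theta> * deriv f (cis \<theta>) = \<i> * of_real (cmod (deriv f (cis \<theta>))) * cis (\<psi> \<theta>)" for \<theta>
  proof -
    have "deriv f (cis \<theta>) = exp (Ln (deriv f (cis \<theta>)))" using nz by simp
    also have "\<dots> = of_real (exp (Re (Ln (deriv f (cis \<theta>))))) * cis (Im (Ln (deriv f (cis \<theta>))))"
      by (rule exp_eq_polar)
    finally have "deriv f (cis \<theta>) = of_real (cmod (deriv f (cis \<theta>))) * cis (Im (Ln (deriv f (cis \<theta>))))"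
      using nz by simp
    then show ?thesis by (simp add: \<psi>_def cis_mult[symmetric] mult_ac)
  qed
  have D': "(D has_real_derivative cmod (deriv f w0) * cmod (deriv f (cis \<theta>)) * sin (\<psi> \<theta> - \<psi> \<theta>0)) (at \<theta>)" for \<theta>
  proof -
    have "((\<lambda>\<theta>. cnj (\<i> * w0 * deriv f w0) * (\<gamma> \<theta> - \<gamma> \<theta>0)) has_vector_derivative
        cnj (\<i> * w0 * deriv f w0) * (\<i> * cis \<theta> * deriv f (cis \<theta>) - 0)) (at \<theta>)"
      by (intro has_vector_derivative_mult_right has_vector_derivative_diff \<gamma>d has_vector_derivative_const)
    from bounded_linear.has_vector_derivative[OF bounded_linear_Im this]
    have "(D has_real_derivative Im (cnj (\<i> * w0 * deriv f w0) * (\<i> * cis \<theta> * deriv f (cis \<theta>)))) (at \<theta>)"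
      by (simp only: D_def[abs_def] has_real_derivative_iff_has_vector_derivative diff_zero)
    also have "cnj (\<i> * w0 * deriv f w0) * (\<i> * cis \<theta> * deriv f (cis \<theta>)) =
        of_real (cmod (deriv f w0) * cmod (deriv f (cis \<theta>))) * cis (\<psi> \<theta> - \<psi> \<theta>0)"
      unfolding w0 polar by (simp add: cis_cnj cis_divide[symmetric] divide_inverse cis_inverse mult_ac)
    finally show ?thesis by simp
  qed
  have \<psi>': "(\<psi> has_real_derivative Re (cnj (deriv f (cis \<theta>)) * (deriv f (cis \<theta>) + cis \<theta> * deriv (deriv f) (cis \<theta>)))
      / (cmod (deriv f (cis \<theta>)))\<^sup>2) (at \<theta>)" for \<theta>
  proof -
    let ?d = "deriv f (cis \<theta>)" and ?e = "deriv (deriv f) (cis \<theta>)"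
    have notneg: "?d \<notin> \<real>\<^sub>\<le>\<^sub>0"
      using pos[of "cis \<theta>"] by (auto simp: complex_nonpos_Reals_iff)
    have "((\<lambda>\<theta>. deriv f (cis \<theta>)) has_vector_derivative \<i> * cis \<theta> * ?e) (at \<theta>)"
      using field_vector_diff_chain_at[OF cisd fdd] by (simp add: o_def)
    from field_vector_diff_chain_at[OF this has_field_derivative_Ln[OF notneg]]
    have "((\<lambda>\<theta>. Ln (deriv f (cis \<theta>))) has_vector_derivative \<i> * cis \<theta> * ?e * inverse ?d) (at \<theta>)"
      by (simp add: o_def)
    from bounded_linear.has_vector_derivative[OF bounded_linear_Im this]
    have "((\<lambda>\<theta>. Im (Ln (deriv f (cis \<theta>)))) has_real_derivative Im (\<i> * cis \<theta> * ?e * inverse ?d)) (at \<theta>)"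
      by (simp add: has_real_derivative_iff_has_vector_derivative)
    from DERIV_add[OF DERIV_ident this]
    have "(\<psi> has_real_derivative 1 + Im (\<i> * cis \<theta> * ?e * inverse ?d)) (at \<theta>)"
      by (simp only: \<psi>_def[abs_def])
    also have "Im (\<i> * cis \<theta> * ?e * inverse ?d) = Re (cis \<theta> * ?e / ?d)"
      by (simp add: divide_inverse mult.assoc)
    also have "1 + Re (cis \<theta> * ?e / ?d) = Re ((?d + cis \<theta> * ?e) / ?d)"
      using nz[of \<theta>] by (simp add: add_divide_distrib)
    also have "\<dots> = Re (cnj ?d * (?d + cis \<theta> * ?e)) / (cmod ?d)\<^sup>2"
      by (subst complex_div_cnj) (simp add: mult.commute Re_divide_of_real flip: of_real_power)
    finally show ?thesis .
  qed
  have \<psi>pos: "\<exists>y. (\<psi> has_real_derivative y) (at \<theta>) \<and> y > 0" for \<theta>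
    using \<psi>'[of \<theta>] conv[of "cis \<theta>"] nz[of \<theta>] by (intro exI conjI) (assumption, simp)
  have mono: "\<psi> a < \<psi> b" if "a < b" for a b
    by (rule DERIV_pos_imp_increasing[OF that]) (use \<psi>pos in blast)
  have period: "cis (\<theta>0 + 2 * pi) = cis \<theta>0" by (simp add: cis_mult[symmetric])
  have \<psi>per: "\<psi> (\<theta>0 + 2 * pi) = \<psi> \<theta>0 + 2 * pi" by (simp add: \<psi>_def period)
  have "continuous_on {\<theta>0..\<theta>0 + 2 * pi} \<psi>"
    by (intro continuous_at_imp_continuous_on ballI DERIV_isCont[OF \<psi>'])
  \<comment> \<open>At \<open>\<theta>1\<close> the tangent is antiparallel to the one at
    \<open>w0\<close>: \<open>D\<close> increases from 0 up to there and then decreases back to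
    0.\<close>
  then obtain \<theta>1 where \<theta>1: "\<theta>0 \<le> \<theta>1" "\<theta>1 \<le> \<theta>0 + 2 * pi" "\<psi> \<theta>1 = \<psi> \<theta>0 + pi"
    using IVT'[of \<psi> \<theta>0 "\<psi> \<theta>0 + pi" "\<theta>0 + 2 * pi"] \<psi>per by auto
  have cont: "continuous_on S D" for S
    by (intro continuous_at_imp_continuous_on ballI DERIV_isCont[OF D'])
  have n0: "cmod (deriv f w0) > 0" using nz w0 by simp
  have D0: "D \<theta>0 = 0" "D (\<theta>0 + 2 * pi) = 0" by (simp_all add: D_def \<gamma>_def period)
  have Dpos: "D \<theta> > 0" if \<theta>: "\<theta>0 < \<theta>" "\<theta> < \<theta>0 + 2 * pi" for \<theta>
  proof (cases "\<theta> \<le> \<theta>1")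
    case True
    have "D \<theta>0 < D \<theta>"
    proof (rule DERIV_pos_imp_increasing_open[OF \<theta>(1) _ cont])
      fix x assume x: "\<theta>0 < x" "x < \<theta>"
      have "0 < sin (\<psi> x - \<psi> \<theta>0)"
        using mono[OF x(1)] mono[of x \<theta>1] x True \<theta>1(3) by (intro sin_gt_zero) auto
      then show "\<exists>y. (D has_real_derivative y) (at x) \<and> y > 0"
        using D'[of x] n0 nz[of x] by (intro exI conjI) (assumption, simp)
    qed
    then show ?thesis using D0 by simp
  next
    case False
    have "D \<theta> > D (\<theta>0 + 2 * pi)"
    proof (rule DERIV_neg_imp_decreasing_open[OF \<theta>(2) _ cont])
      fix x assume x: "\<theta> < x" "x < \<theta>0 + 2 * pi"
      have "sin (\<psi> x - \<psi> \<theta>0) < 0"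
        using mono[OF x(2)] mono[of \<theta>1 x] x False \<theta>1(3) \<psi>per by (intro sin_lt_zero) auto
      then show "\<exists>y. (D has_real_derivative y) (at x) \<and> y < 0"
        using D'[of x] n0 nz[of x] by (intro exI conjI) (assumption, simp add: mult_pos_neg)
    qed
    then show ?thesis using D0 by simp
  qed
  define \<alpha> where "\<alpha> = Arg2pi (w / w0)"
  have w0nz: "w0 \<noteq> 0" using w(1) by auto
  have "w / w0 = cis \<alpha>"
    using Arg2pi_eq[of "w / w0"] w by (simp add: \<alpha>_def norm_divide cis_conv_exp)
  then have weq: "w = cis (\<theta>0 + \<alpha>)" using w0nz w0 by (simp add: cis_mult[symmetric] field_simps)
  have "0 \<le> \<alpha>" "\<alpha> < 2 * pi" using Arg2pi[of "w / w0"] by (auto simp: \<alpha>_def)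
  moreover have "\<alpha> \<noteq> 0" using weq w0 w(3) by auto
  ultimately have "D (\<theta>0 + \<alpha>) > 0" by (intro Dpos) auto
  then show ?thesis by (simp add: D_def \<gamma>_def flip: weq w0)
qed

lemma convex_conformal_image:
  assumes f: "f holomorphic_on UNIV"
    and pos: "\<And>w. cmod w = 1 \<Longrightarrow> Re (deriv f w) > 0"
    and conv: "\<And>w. cmod w = 1 \<Longrightarrow> Re (cnj (deriv f w) * (deriv f w + w * deriv (deriv f) w)) > 0"
    and inj: "inj_on f (ball 0 1)"
  shows "convex (f ` ball 0 1)"
proof -
  define c where "c w = cnj (\<i> * w * deriv f w)" for w
  define C where "C = (\<Inter>w\<in>sphere 0 1. {z. 0 < Im (c w * (z - f w))})"
  have c0: "c w \<noteq> 0" if "cmod w = 1" for w using pos[OF that] that by (auto simp: c_def)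
  have side: "0 \<le> Im (c w0 * (f w - f w0))" if "cmod w0 = 1" "cmod w = 1" for w0 w
    using convex_curve_side_of_tangent[OF f pos conv that] unfolding c_def by (cases "w = w0") auto
  have "convex {z. 0 < Im (c w * (z - f w))}" for w
  proof (rule convexI)
    fix x y and a b :: real
    assume xy: "x \<in> {z. 0 < Im (c w * (z - f w))}" "y \<in> {z. 0 < Im (c w * (z - f w))}" and ab: "0 \<le> a" "0 \<le> b" "a + b = 1"
    have b: "b = 1 - a" using ab by simp
    have "Im (c w * ((a *\<^sub>R x + b *\<^sub>R y) - f w)) = a * Im (c w * (x - f w)) + b * Im (c w * (y - f w))"
      unfolding b by (simp add: algebra_simps)
    also have "\<dots> > 0"
    proof (cases "a = 0")
      case True then show ?thesis using xy ab by simp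
    next
      case False then show ?thesis using xy ab by (intro add_pos_nonneg) auto
    qed
    finally show "a *\<^sub>R x + b *\<^sub>R y \<in> {z. 0 < Im (c w * (z - f w))}" by simp
  qed
  then have convC: "convex C" unfolding C_def by (intro convex_INT) auto
  have opn: "open (f ` ball 0 1)"
    by (rule open_mapping_thm3[OF holomorphic_on_subset[OF f subset_UNIV] _ inj]) auto
  have subC: "f ` ball 0 1 \<subseteq> C"
  proof -
    have "0 < Im (c w0 * (z - f w0))" if w0: "cmod w0 = 1" and z: "z \<in> f ` ball 0 1" for w0 z
    proof -
      have le: "0 \<le> Im (c w0 * (y - f w0))" if y: "y \<in> f ` ball 0 1" for y
      proof -
        obtain w where w: "w \<in> ball 0 1" "y = f w" using y by blast
        have hol: "(\<lambda>w. \<i> * (c w0 * (f w - f w0))) holomorphic_on UNIV" by (intro holomorphic_intros f)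
        have "Re (\<i> * (c w0 * (f w - f w0))) \<le> 0"
        proof (rule maximum_real_frontier[of "\<lambda>w. \<i> * (c w0 * (f w - f w0))" "ball 0 1"])
          show "continuous_on (closure (ball 0 1)) (\<lambda>w. \<i> * (c w0 * (f w - f w0)))"
            using holomorphic_on_imp_continuous_on[OF hol] continuous_on_subset by blast
          show "Re (\<i> * (c w0 * (f z - f w0))) \<le> 0" if "z \<in> frontier (ball 0 1)" for z
            using side[OF w0, of z] that by simp
        qed (use w holomorphic_on_subset[OF hol] in auto)
        then show ?thesis by (simp add: w)
      qed
      \<comment> \<open>The maximum principle gives only a weak inequality. Openness of the image
        lets \<open>z\<close> move towards the tangent by \<open>e / 2\<close>, and the weak
        inequality there is a strict one at \<open>z\<close>.\<close>
      obtain e where e: "e > 0" "ball z e \<subseteq> f ` ball 0 1" using opn z open_contains_ball by blast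
      define \<delta> where "\<delta> = e / (2 * cmod (c w0))"
      have \<delta>: "\<delta> > 0" using e c0[OF w0] by (simp add: \<delta>_def)
      have "z - \<i> * cnj (c w0) * \<delta> \<in> ball z e"
        using e \<delta> c0[OF w0] by (simp add: dist_norm norm_mult norm_divide \<delta>_def)
      then have "0 \<le> Im (c w0 * (z - \<i> * cnj (c w0) * \<delta> - f w0))" using e le by blast
      also have "c w0 * (z - \<i> * cnj (c w0) * \<delta> - f w0) = c w0 * (z - f w0) - \<i> * of_real ((cmod (c w0))\<^sup>2 * \<delta>)"
        by (simp add: complex_norm_square algebra_simps del: of_real_power)
      finally have "(cmod (c w0))\<^sup>2 * \<delta> \<le> Im (c w0 * (z - f w0))" by simp
      moreover have "(cmod (c w0))\<^sup>2 * \<delta> > 0" using \<delta> c0[OF w0] by simp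
      ultimately show ?thesis by linarith
    qed
    then show ?thesis by (auto simp: C_def)
  qed
  have eq: "f ` ball 0 1 = C \<inter> f ` cball 0 1"
  proof
    show "f ` ball 0 1 \<subseteq> C \<inter> f ` cball 0 1" using subC by auto
    show "C \<inter> f ` cball 0 1 \<subseteq> f ` ball 0 1"
    proof
      fix z assume z: "z \<in> C \<inter> f ` cball 0 1"
      then obtain w where w: "w \<in> cball 0 1" "z = f w" by blast
      have "cmod w \<noteq> 1"
      proof
        assume "cmod w = 1"
        then have "0 < Im (c w * (z - f w))" using z by (auto simp: C_def)
        then show False by (simp add: w)
      qed
      then show "z \<in> f ` ball 0 1" using w by auto
    qed
  qed
  have "compact (f ` cball 0 1)"
    by (intro compact_continuous_image holomorphic_on_imp_continuous_on holomorphic_on_subset[OF f]) auto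
  then have "closedin (top_of_set C) (f ` ball 0 1)"
    unfolding eq by (intro closedin_closed_Int compact_imp_closed)
  moreover have "openin (top_of_set C) (f ` ball 0 1)"
    using opn subC by (metis openin_open_Int inf.absorb_iff2)
  moreover have "connected C" using convC by (rule convex_connected)
  ultimately have "f ` ball 0 1 = {} \<or> f ` ball 0 1 = C" using connected_clopen by blast
  then show ?thesis using convC by auto
qed

section \<open>The torsion function of a conformal image\<close>

lemma Re_holomorphic_has_derivative:
  assumes H: "H holomorphic_on S" and S: "open S" and x: "cx x \<in> S"
  shows "((\<lambda>y. Re (H (cx y) * c)) has_derivative (\<lambda>h. Re (deriv H (cx x) * cx h * c))) (at x)"
proof -
  have "(H has_derivative (\<lambda>h. deriv H (cx x) * h)) (at (cx x))"
    using holomorphic_derivI[OF H S x] by (simp add: has_field_derivative_def)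
  from has_derivative_compose[OF bounded_linear_imp_has_derivative[OF bounded_linear_cx] this]
  have "((\<lambda>y. H (cx y)) has_derivative (\<lambda>h. deriv H (cx x) * cx h)) (at x)" .
  from has_derivative_mult_left[OF this, of c]
  have "((\<lambda>y. H (cx y) * c) has_derivative (\<lambda>h. deriv H (cx x) * cx h * c)) (at x)" .
  then show ?thesis by (rule bounded_linear.has_derivative[OF bounded_linear_Re])
qed

context
  fixes H :: "complex \<Rightarrow> complex" and \<Omega> :: "(real^2) set" and u :: "real^2 \<Rightarrow> real"
  assumes H: "H holomorphic_on cx ` \<Omega>" and \<Omega>: "open \<Omega>"
    and u: "\<And>x. u x = (Re (H (cx x)) - (norm x)\<^sup>2) / 4"
begin

lemma grad_Re_holomorphic:
  assumes x: "x \<in> \<Omega>"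
  shows "u differentiable (at x)"
    and "grad u x $ i = (Re (deriv H (cx x) * cx (axis i 1)) - 2 * x $ i) / 4"
proof -
  have "cx x \<in> cx ` \<Omega>" using x by blast
  then have "((\<lambda>y. (Re (H (cx y) * 1) - y \<bullet> y) / 4) has_derivative
     (\<lambda>h. (Re (deriv H (cx x) * cx h * 1) - (x \<bullet> h + h \<bullet> x)) / 4)) (at x)"
    by (intro bounded_linear.has_derivative[OF bounded_linear_divide] has_derivative_diff
        has_derivative_inner has_derivative_ident Re_holomorphic_has_derivative[OF H open_cx_image[OF \<Omega>]])
  then have D: "(u has_derivative (\<lambda>h. (Re (deriv H (cx x) * cx h) - 2 * (x \<bullet> h)) / 4)) (at x)"
    unfolding u[abs_def] power2_norm_eq_inner by (simp add: inner_commute)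
  then show "u differentiable (at x)" by (rule differentiableI)
  show "grad u x $ i = (Re (deriv H (cx x) * cx (axis i 1)) - 2 * x $ i) / 4"
    unfolding grad_def by (simp add: frechet_derivative_at[OF D, symmetric] inner_axis)
qed

lemma second_partial_Re_holomorphic:
  assumes x: "x \<in> \<Omega>"
  shows "(\<lambda>y. grad u y $ i) differentiable (at x)"
    and "second_partial u i j x =
      (Re (deriv (deriv H) (cx x) * cx (axis j 1) * cx (axis i 1)) - 2 * (axis j 1 :: real^2) $ i) / 4"
proof -
  have dH: "deriv H holomorphic_on cx ` \<Omega>"
    using H \<Omega> by (intro holomorphic_deriv open_cx_image)
  have "((\<lambda>y. y $ i) has_derivative (\<lambda>h. h $ i)) (at x)"
    by (rule bounded_linear_imp_has_derivative) (rule bounded_linear_vec_nth)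
  moreover have "cx x \<in> cx ` \<Omega>" using x by blast
  ultimately have "((\<lambda>y. (Re (deriv H (cx y) * cx (axis i 1)) - 2 * y $ i) / 4) has_derivative
     (\<lambda>h. (Re (deriv (deriv H) (cx x) * cx h * cx (axis i 1)) - 2 * h $ i) / 4)) (at x)"
    by (intro bounded_linear.has_derivative[OF bounded_linear_divide] has_derivative_diff
        has_derivative_mult_right Re_holomorphic_has_derivative[OF dH open_cx_image[OF \<Omega>]])
  then have D: "((\<lambda>y. grad u y $ i) has_derivative
     (\<lambda>h. (Re (deriv (deriv H) (cx x) * cx h * cx (axis i 1)) - 2 * h $ i) / 4)) (at x)"
    by (rule has_derivative_transform_within_open[OF _ \<Omega> x]) (simp add: grad_Re_holomorphic)
  then show "(\<lambda>y. grad u y $ i) differentiable (at x)" by (rule differentiableI)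
  show "second_partial u i j x =
      (Re (deriv (deriv H) (cx x) * cx (axis j 1) * cx (axis i 1)) - 2 * (axis j 1 :: real^2) $ i) / 4"
    unfolding second_partial_def by (simp add: frechet_derivative_at[OF D, symmetric])
qed

text \<open>\<open>Re H\<close> is harmonic and \<open>|x|^2\<close> has Laplacian 4, so the form of
  \<open>u\<close> already solves the equation; only the boundary behaviour is left as a
  hypothesis.\<close>

lemma torsion_function_Re_holomorphic:
  assumes cont: "continuous_on (closure \<Omega>) u" and bd: "\<And>x. x \<in> frontier \<Omega> \<Longrightarrow> u x = 0"
  shows "torsion_function \<Omega> u"
  unfolding torsion_function_def C2_on_def
proof (intro conjI ballI allI)
  fix i j
  have "deriv (deriv H) holomorphic_on cx ` \<Omega>"
    using H \<Omega> by (intro holomorphic_deriv open_cx_image)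
  then have "continuous_on \<Omega> (\<lambda>x. deriv (deriv H) (cx x))"
    by (rule continuous_on_compose2[OF holomorphic_on_imp_continuous_on])
      (auto intro!: continuous_on_cx continuous_on_id)
  then have "continuous_on \<Omega> (\<lambda>x. (Re (deriv (deriv H) (cx x) * cx (axis j 1) * cx (axis i 1)) - 2 * (axis j 1 :: real^2) $ i) / 4)"
    by (intro continuous_intros) auto
  then show "continuous_on \<Omega> (second_partial u i j)"
    by (rule continuous_on_cong[THEN iffD1, rotated 2]) (auto simp: second_partial_Re_holomorphic)
next
  fix x assume x: "x \<in> \<Omega>"
  show "- laplacian u x = 1"
    unfolding laplacian_def UNIV_2 by (simp add: second_partial_Re_holomorphic[OF x] axis_def field_simps)
qed (use cont bd grad_Re_holomorphic second_partial_Re_holomorphic in auto)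

end

text \<open>Positivity of \<open>Re (deriv f)\<close> on the closed disc makes \<open>f\<close>
  injective up to the circle, so by compactness its inverse \<open>G\<close> is continuous on the
  closed image. This is what makes \<open>u\<close> continuous on the closure and zero on the
  frontier.\<close>

lemma conformal_torsion:
  assumes f: "f holomorphic_on UNIV"
    and pos: "\<And>w. w \<in> cball 0 1 \<Longrightarrow> Re (deriv f w) > 0"
    and conv: "\<And>w. cmod w = 1 \<Longrightarrow> Re (cnj (deriv f w) * (deriv f w + w * deriv (deriv f) w)) > 0"
    and Q: "Q holomorphic_on UNIV" "\<And>w. cmod w = 1 \<Longrightarrow> Re (Q w) = (cmod (f w))\<^sup>2"
  defines "\<Omega> \<equiv> rv ` f ` ball 0 1"
  shows "bounded_convex_domain \<Omega>"
    and "\<exists>u. torsion_function \<Omega> u \<and> (\<forall>w\<in>ball 0 1. u (rv (f w)) = (Re (Q w) - (cmod (f w))\<^sup>2) / 4)"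
proof -
  have inj: "inj_on f (cball 0 1)"
    by (rule Re_deriv_pos_imp_inj_on[OF f]) (use pos in auto)
  then have injb: "inj_on f (ball 0 1)" by (rule inj_on_subset) auto
  have opn: "open (f ` ball 0 1)"
    by (rule open_mapping_thm3[OF holomorphic_on_subset[OF f subset_UNIV] _ injb]) auto
  have cont: "continuous_on (cball 0 1) f"
    by (rule holomorphic_on_imp_continuous_on[OF holomorphic_on_subset[OF f subset_UNIV]])
  have comp: "compact (rv ` f ` cball 0 1)"
    by (intro compact_continuous_image cont continuous_on_rv continuous_on_id) auto
  have \<Omega>: "open \<Omega>" unfolding \<Omega>_def by (rule open_rv_image[OF opn])
  have cl: "closure \<Omega> \<subseteq> rv ` f ` cball 0 1"
    unfolding \<Omega>_def by (rule closure_minimal) (use comp compact_imp_closed in \<open>auto intro!: image_mono\<close>)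
  have "convex (f ` ball 0 1)"
    using convex_conformal_image[OF f _ conv injb] pos by auto
  moreover have "bounded \<Omega>" using comp cl closure_subset by (meson bounded_subset compact_imp_bounded)
  ultimately show "bounded_convex_domain \<Omega>"
    using \<Omega> convex_linear_image[OF linear_rv] by (auto simp: bounded_convex_domain_def \<Omega>_def)
  define G where "G = the_inv_into (cball 0 1) f"
  have G: "G (f w) = w" if "w \<in> cball 0 1" for w
    unfolding G_def using the_inv_into_f_f[OF inj that] .
  have contG: "continuous_on (f ` cball 0 1) G"
    by (rule continuous_on_inv[OF cont]) (use G in auto)
  obtain g where g: "g holomorphic_on f ` ball 0 1" "\<And>z. z \<in> ball 0 1 \<Longrightarrow> g (f z) = z"
    using holomorphic_has_inverse[OF holomorphic_on_subset[OF f subset_UNIV] open_ball injb] by metis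
  have "G holomorphic_on f ` ball 0 1"
    by (rule holomorphic_transform[OF g(1)]) (use g(2) G in auto)
  then have QG: "(\<lambda>z. Q (G z)) holomorphic_on cx ` \<Omega>"
    using holomorphic_on_compose_gen[OF _ Q(1), of G "cx ` \<Omega>"] by (simp add: o_def \<Omega>_def image_image)
  define u where "u x = (Re (Q (G (cx x))) - (norm x)\<^sup>2) / 4" for x
  have uf: "u (rv (f w)) = (Re (Q w) - (cmod (f w))\<^sup>2) / 4" if "w \<in> cball 0 1" for w
    using G[OF that] by (simp add: u_def)
  have "torsion_function \<Omega> u"
  proof (rule torsion_function_Re_holomorphic[OF QG \<Omega> u_def])
    have "continuous_on (rv ` f ` cball 0 1) (\<lambda>x. Q (G (cx x)))"
      by (intro continuous_on_compose2[OF holomorphic_on_imp_continuous_on[OF Q(1)]]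
          continuous_on_compose2[OF contG] continuous_intros) auto
    then have "continuous_on (rv ` f ` cball 0 1) u"
      unfolding u_def by (intro continuous_intros) auto
    then show "continuous_on (closure \<Omega>) u" using cl continuous_on_subset by blast
    show "u x = 0" if "x \<in> frontier \<Omega>" for x
    proof -
      have "x \<in> closure \<Omega>" "x \<notin> \<Omega>" using that \<Omega> by (auto simp: frontier_def interior_open)
      then obtain w where w: "w \<in> cball 0 1" "x = rv (f w)" using cl by blast
      have "cmod w = 1" using w \<open>x \<notin> \<Omega>\<close> by (force simp: \<Omega>_def)
      then show ?thesis using uf[OF w(1)] Q(2) w by simp
    qed
  qed
  then show "\<exists>u. torsion_function \<Omega> u \<and> (\<forall>w\<in>ball 0 1. u (rv (f w)) = (Re (Q w) - (cmod (f w))\<^sup>2) / 4)"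
    using uf by (intro exI[of _ u]) auto
qed

text \<open>The gradient bound holds at interior points, so the derivative of \<open>u\<close> along
  \<open>f s\<close> is estimated for \<open>0 < s < 1\<close> by the chain rule. The explicit
  formula for it is continuous in \<open>s\<close> and survives the passage to
  \<open>s = 1\<close>.\<close>

lemma radial_derivative_le_gradient_bound:
  assumes f: "f holomorphic_on UNIV" and Q: "Q holomorphic_on UNIV"
    and tors: "torsion_function \<Omega> u" and img: "rv ` f ` ball 0 1 \<subseteq> \<Omega>"
    and u: "\<And>w. w \<in> ball 0 1 \<Longrightarrow> u (rv (f w)) = (Re (Q w) - (cmod (f w))\<^sup>2) / 4"
    and bd: "\<And>x. x \<in> \<Omega> \<Longrightarrow> norm (grad u x) \<le> \<kappa>"
  shows "\<bar>Re (deriv Q 1) - 2 * Re (cnj (f 1) * deriv f 1)\<bar> / 4 \<le> \<kappa> * cmod (deriv f 1)"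
proof -
  define d where "d s = (Re (deriv Q (of_real s)) - 2 * Re (cnj (f (of_real s)) * deriv f (of_real s))) / 4" for s :: real
  have real: "((\<lambda>s. h (complex_of_real s)) has_vector_derivative deriv h (of_real s)) (at s)"
    if "h holomorphic_on UNIV" for h s
    by (rule has_vector_derivative_real_field) (use that holomorphic_derivI in blast)
  have main: "\<bar>d s\<bar> \<le> \<kappa> * cmod (deriv f (of_real s))" if s: "0 < s" "s < 1" for s
  proof -
    let ?x = "rv (f (of_real s))"
    have x: "?x \<in> \<Omega>" using img s by auto
    have "((\<lambda>s. rv (f (of_real s))) has_derivative (\<lambda>h. rv (h *\<^sub>R deriv f (of_real s)))) (at s)"
      using bounded_linear.has_derivative[OF bounded_linear_rv real[OF f, unfolded has_vector_derivative_def]] .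
    moreover have "(u has_derivative (\<lambda>h. grad u ?x \<bullet> h)) (at ?x)"
      using tors x by (intro frechet_derivative_eq_grad) (auto simp: torsion_function_def C2_on_def)
    ultimately have "((\<lambda>s. u (rv (f (of_real s)))) has_derivative (\<lambda>h. grad u ?x \<bullet> rv (h *\<^sub>R deriv f (of_real s)))) (at s)"
      by (rule has_derivative_compose)
    moreover have "rv (h *\<^sub>R z) = h *\<^sub>R rv z" for h z by (simp add: vec_eq_iff forall_2)
    ultimately have D1: "((\<lambda>s. u (rv (f (of_real s)))) has_real_derivative grad u ?x \<bullet> rv (deriv f (of_real s))) (at s)"
      unfolding has_field_derivative_def by (elim has_derivative_eq_rhs) (auto simp: fun_eq_iff)
    have "((\<lambda>s. (Re (Q (of_real s)) - Re (cnj (f (of_real s)) * f (of_real s))) / 4) has_vector_derivative d s) (at s)"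
    proof -
      have "((\<lambda>s. Re (Q (of_real s))) has_vector_derivative Re (deriv Q (of_real s))) (at s)"
        by (rule bounded_linear.has_vector_derivative[OF bounded_linear_Re real[OF Q]])
      moreover have "((\<lambda>s. Re (cnj (f (of_real s)) * f (of_real s))) has_vector_derivative
          Re (cnj (f (of_real s)) * deriv f (of_real s) + cnj (deriv f (of_real s)) * f (of_real s))) (at s)"
        by (intro bounded_linear.has_vector_derivative[OF bounded_linear_Re] has_vector_derivative_mult
            bounded_linear.has_vector_derivative[OF bounded_linear_cnj] real f)
      ultimately have "((\<lambda>s. (Re (Q (of_real s)) - Re (cnj (f (of_real s)) * f (of_real s))) / 4) has_vector_derivative
          (Re (deriv Q (of_real s)) - Re (cnj (f (of_real s)) * deriv f (of_real s) + cnj (deriv f (of_real s)) * f (of_real s))) / 4) (at s)"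
        by (intro bounded_linear.has_vector_derivative[OF bounded_linear_divide] has_vector_derivative_diff)
      moreover have "Re (cnj (f (of_real s)) * deriv f (of_real s) + cnj (deriv f (of_real s)) * f (of_real s)) =
          2 * Re (cnj (f (of_real s)) * deriv f (of_real s))" by simp
      ultimately show ?thesis by (simp only: d_def)
    qed
    moreover have "Re (cnj z * z) = (cmod z)\<^sup>2" for z
      by (simp add: cmod_power2) (simp add: power2_eq_square)
    ultimately have D2: "((\<lambda>s. (Re (Q (of_real s)) - (cmod (f (of_real s)))\<^sup>2) / 4) has_real_derivative d s) (at s)"
      by (simp only: has_real_derivative_iff_has_vector_derivative)
    have "((\<lambda>s. u (rv (f (of_real s)))) has_real_derivative d s) (at s)"
      by (rule has_field_derivative_transform_within_open[OF D2, of "{0<..<1}"]) (use s u in auto)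
    then have "d s = grad u ?x \<bullet> rv (deriv f (of_real s))" using D1 by (rule DERIV_unique)
    then have "\<bar>d s\<bar> \<le> norm (grad u ?x) * norm (rv (deriv f (of_real s)))"
      by (simp add: Cauchy_Schwarz_ineq2 del: norm_rv)
    also have "\<dots> \<le> \<kappa> * cmod (deriv f (of_real s))"
      using bd[OF x] by (simp add: mult_right_mono)
    finally show ?thesis .
  qed
  have c: "continuous_on UNIV f" "continuous_on UNIV (deriv f)" "continuous_on UNIV (deriv Q)"
    using f Q by (auto intro!: holomorphic_on_imp_continuous_on holomorphic_deriv)
  have "isCont (\<lambda>s. \<bar>d s\<bar>) 1" "isCont (\<lambda>s. \<kappa> * cmod (deriv f (of_real s))) 1"
    unfolding d_def using c
    by (auto intro!: continuous_intros isCont_o2[of _ of_real] simp: continuous_on_eq_continuous_at)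
  then have lim: "((\<lambda>s. \<bar>d s\<bar>) \<longlongrightarrow> \<bar>d 1\<bar>) (at_left 1)"
    "((\<lambda>s. \<kappa> * cmod (deriv f (of_real s))) \<longlongrightarrow> \<kappa> * cmod (deriv f (of_real 1))) (at_left 1)"
    by (auto simp: isCont_def intro: tendsto_within_subset)
  have "\<bar>d 1\<bar> \<le> \<kappa> * cmod (deriv f (of_real 1))"
    by (rule tendsto_le[OF _ lim(2) lim(1)]) (use eventually_at_left_real[of 0 "1::real"] in \<open>auto elim!: eventually_mono intro!: main\<close>)
  then show ?thesis by (simp add: d_def)
qed

section \<open>A domain with large gradient\<close>

text \<open>The open strip under \<open>exp\<close> misses a small disc about 0 and the slit
  \<open>Arg2pi w = 0\<close>. The disc is mapped into a square of side \<open>2 * C * exp s\<close>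
  because \<open>a 0 = 0\<close>, and real coefficients send the slit into the real axis, a null
  set. Then \<open>s\<close> tends to minus infinity.\<close>

lemma measure_real_polynomial_image_le:
  fixes a :: "nat \<Rightarrow> real" and N :: nat
  defines "f \<equiv> \<lambda>w. \<Sum>n\<le>N. complex_of_real (a n) * w ^ n"
  assumes a0: "a 0 = 0" and inj: "inj_on f (ball 0 1)"
  shows "measure lebesgue (rv ` f ` ball 0 1) \<le> pi * (\<Sum>n\<le>N. real n * (a n)\<^sup>2)"
proof -
  define C where "C = (\<Sum>n\<le>N. \<bar>a n\<bar>)"
  define T where "T = (\<Sum>n\<le>N. real n * (a n)\<^sup>2)"
  have f: "f holomorphic_on UNIV" unfolding f_def by (intro holomorphic_intros)
  have df: "deriv f w * w = (\<Sum>n\<le>N. of_real (real n * a n) * w ^ n)" for w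
  proof -
    have "(f has_field_derivative (\<Sum>n\<le>N. of_real (a n) * (of_nat n * w ^ (n - 1)))) (at w)"
      unfolding f_def by (auto intro!: derivative_eq_intros sum.cong)
    then have "deriv f w * w = (\<Sum>n\<le>N. of_real (a n) * (of_nat n * w ^ (n - 1))) * w"
      by (simp add: DERIV_imp_deriv)
    also have "\<dots> = (\<Sum>n\<le>N. of_real (real n * a n) * w ^ n)"
      unfolding sum_distrib_right
    proof (intro sum.cong refl)
      fix n show "of_real (a n) * (of_nat n * w ^ (n - 1)) * w = of_real (real n * a n) * w ^ n"
        by (cases n) (auto simp: mult_ac)
    qed
    finally show ?thesis .
  qed
  have fC: "cmod (f w) \<le> C * cmod w" if "cmod w \<le> 1" for w
  proof -
    have "cmod (f w) \<le> (\<Sum>n\<le>N. cmod (of_real (a n) * w ^ n))" unfolding f_def by (rule norm_sum)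
    also have "\<dots> \<le> (\<Sum>n\<le>N. \<bar>a n\<bar> * cmod w)"
    proof (rule sum_mono)
      fix n show "cmod (of_real (a n) * w ^ n) \<le> \<bar>a n\<bar> * cmod w"
      proof (cases n)
        case (Suc m)
        have "cmod w ^ Suc m \<le> cmod w" using that by (simp add: mult_left_le power_le_one)
        then show ?thesis unfolding Suc norm_mult norm_power by (simp add: mult_left_mono)
      qed (simp add: a0)
    qed
    finally show ?thesis by (simp add: C_def sum_distrib_right)
  qed
  have "C \<ge> 0" by (simp add: C_def sum_nonneg)
  have bound: "measure lebesgue (rv ` f ` ball 0 1) \<le> pi * T + (2 * (C * exp s))\<^sup>2" if s: "s < 0" for s
  proof -
    define X where "X = rv ` f ` exp ` {z. s < Re z \<and> Re z < 0 \<and> 0 < Im z \<and> Im z < 2 * pi}"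
    define Y where "Y = cbox (rv (Complex (- (C * exp s)) (- (C * exp s)))) (rv (Complex (C * exp s) (C * exp s)))"
    define Z where "Z = {x::real^2. x $ 2 = 0}"
    have m: "X \<in> lmeasurable" "measure lebesgue X = integral {s..0} (\<lambda>s. integral {0..2*pi}
      (\<lambda>t. (cmod (deriv f (exp (Complex s t)) * exp (Complex s t)))\<^sup>2))"
      unfolding X_def using measure_image_exp_box[OF f, of 0 s] inj by auto
    have "measure lebesgue X = integral {s..0} (\<lambda>s. integral {0..2*pi}
      (\<lambda>t. (cmod (\<Sum>n\<le>N. of_real (real n * a n) * exp (of_nat n * Complex s t)))\<^sup>2))"
      unfolding m(2) df by (simp add: exp_of_nat_mult)
    also have "\<dots> = pi * (\<Sum>n\<le>N. (cmod (of_real (real n * a n)))\<^sup>2 / n * (exp (2 * real n * 0) - exp (2 * real n * s)))"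
      by (rule integral_Parseval_exp) (use s in auto)
    also have "\<dots> \<le> pi * T"
      unfolding T_def
    proof (intro mult_left_mono sum_mono)
      fix n
      have "(cmod (of_real (real n * a n)))\<^sup>2 / n = real n * (a n)\<^sup>2"
        by (cases "n = 0") (auto simp: norm_mult power2_eq_square abs_mult_self_eq simp flip: abs_mult)
      moreover have "exp (2 * real n * 0) - exp (2 * real n * s) \<le> 1" by simp
      ultimately show "(cmod (of_real (real n * a n)))\<^sup>2 / n * (exp (2 * real n * 0) - exp (2 * real n * s)) \<le> real n * (a n)\<^sup>2"
        by (metis mult_left_le mult_nonneg_nonneg of_nat_0_le_iff zero_le_power2)
    qed simp
    finally have mX: "measure lebesgue X \<le> pi * T" .
    have mY: "measure lebesgue Y = (2 * (C * exp s))\<^sup>2"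
    proof -
      have "Y \<noteq> {}" using \<open>C \<ge> 0\<close> unfolding Y_def interval_ne_empty_cart by (simp add: forall_2)
      then have "measure lborel Y = (2 * (C * exp s))\<^sup>2"
        unfolding Y_def by (simp add: content_cbox_cart UNIV_2 power2_eq_square)
      then show ?thesis by (simp add: Y_def)
    qed
    have nZ: "negligible Z" unfolding Z_def by (rule negligible_standard_hyperplane_cart)
    have cover: "rv ` f ` ball 0 1 \<subseteq> X \<union> Y \<union> Z"
    proof
      fix x assume "x \<in> rv ` f ` ball 0 1"
      then obtain w where w: "cmod w < 1" "x = rv (f w)" by auto
      consider "cmod w \<le> exp s" | "Arg2pi w = 0" | "cmod w > exp s" "Arg2pi w \<noteq> 0" by linarith
      then show "x \<in> X \<union> Y \<union> Z"
      proof cases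
        case 1
        have "cmod (f w) \<le> C * exp s"
          using fC[of w] w 1 \<open>C \<ge> 0\<close> by (meson less_imp_le mult_left_mono order_trans)
        then have "\<bar>Re (f w)\<bar> \<le> C * exp s" "\<bar>Im (f w)\<bar> \<le> C * exp s"
          using abs_Re_le_cmod[of "f w"] abs_Im_le_cmod[of "f w"] by linarith+
        then have "x \<in> Y" unfolding Y_def w(2) mem_box_cart by (auto simp: forall_2 abs_le_iff)
        then show ?thesis by blast
      next
        case 2
        then have "w \<in> \<real>" using Arg2pi_eq_0 by blast
        then obtain y where "w = of_real y" by (elim Reals_cases)
        then have "Im (f w) = 0" by (simp add: f_def flip: of_real_power)
        then show ?thesis by (simp add: Z_def w(2))
      next
        case 3
        have "w \<noteq> 0" using 3 by auto
        define z where "z = Complex (ln (cmod w)) (Arg2pi w)"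
        have "exp z = w"
          using Arg2pi_eq[of w] \<open>w \<noteq> 0\<close> by (simp add: z_def Complex_eq exp_add exp_of_real)
        moreover have "s < ln (cmod w)" using 3(1) \<open>w \<noteq> 0\<close> by (metis exp_less_cancel_iff exp_ln zero_less_norm_iff)
        moreover have "ln (cmod w) < 0" using w \<open>w \<noteq> 0\<close> by (simp add: ln_less_zero)
        moreover have "0 < Arg2pi w" "Arg2pi w < 2 * pi" using Arg2pi[of w] 3(2) by auto
        ultimately have "w \<in> exp ` {z. s < Re z \<and> Re z < 0 \<and> 0 < Im z \<and> Im z < 2 * pi}"
          by (intro image_eqI[of _ _ z]) (auto simp: z_def)
        then show ?thesis unfolding X_def w(2) by blast
      qed
    qed
    have opn: "open (f ` ball 0 1)"
      by (rule open_mapping_thm3[OF holomorphic_on_subset[OF f subset_UNIV] _ inj]) auto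
    have lY: "Y \<in> lmeasurable" and lZ: "Z \<in> lmeasurable" using nZ by (auto simp: Y_def negligible_imp_measurable)
    have "measure lebesgue (rv ` f ` ball 0 1) \<le> measure lebesgue (X \<union> Y \<union> Z)"
      by (rule measure_mono_fmeasurable[OF cover])
        (use open_rv_image[OF opn] m(1) lY lZ in \<open>auto intro!: fmeasurable.Un\<close>)
    also have "\<dots> \<le> measure lebesgue X + measure lebesgue Y + measure lebesgue Z"
      using measure_Un_le[of X lebesgue Y] measure_Un_le[of "X \<union> Y" lebesgue Z] m(1) lY lZ by (simp add: fmeasurableD)
    also have "measure lebesgue Z = 0" using nZ lZ negligible_iff_measure by blast
    finally show ?thesis using mX mY by simp
  qed
  have "(\<lambda>j. exp (- real (Suc j))) \<longlonglongrightarrow> 0" by real_asymp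
  then have "(\<lambda>j. pi * T + (2 * (C * exp (- real (Suc j))))\<^sup>2) \<longlonglongrightarrow> pi * T + (2 * (C * 0))\<^sup>2"
    by (intro tendsto_intros)
  then have "measure lebesgue (rv ` f ` ball 0 1) \<le> pi * T + (2 * (C * 0))\<^sup>2"
    by (rule LIMSEQ_le_const) (use bound in auto)
  then show ?thesis by (simp add: T_def)
qed

section \<open>Integer polynomials as coefficient lists, and positivity certificates\<close>

primrec pev :: "int list \<Rightarrow> complex \<Rightarrow> complex" where
  "pev [] w = 0"
| "pev (a # as) w = of_int a + w * pev as w"

fun padd :: "int list \<Rightarrow> int list \<Rightarrow> int list" where
  "padd [] ys = ys"
| "padd xs [] = xs"
| "padd (x # xs) (y # ys) = (x + y) # padd xs ys"

text \<open>The product rule for the Horner step \<open>a + w * pev as w\<close>.\<close>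

primrec pdiff :: "int list \<Rightarrow> int list" where
  "pdiff [] = []"
| "pdiff (a # as) = padd as (0 # pdiff as)"

text \<open>Multiplying out \<open>cnj (x + w X) * (y + w Y)\<close> on \<open>|w| = 1\<close>, the
  tails contribute \<open>cnj X * Y\<close> because \<open>cnj w * w = 1\<close>, and conjugating
  \<open>y * cnj (w X)\<close> keeps its real part. So \<open>corr xs xs\<close> is the polynomial
  \<open>Q\<close> belonging to \<open>xs\<close>.\<close>

fun corr :: "int list \<Rightarrow> int list \<Rightarrow> int list" where
  "corr (x # xs) (y # ys) = padd (x * y # padd (map ((*) x) ys) (map ((*) y) xs)) (corr xs ys)"
| "corr _ _ = []"

lemma pev_padd: "pev (padd xs ys) w = pev xs w + pev ys w"
  by (induction xs ys rule: padd.induct) (auto simp: algebra_simps)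

lemma pev_map_mult: "pev (map ((*) c) xs) w = of_int c * pev xs w"
  by (induction xs) (auto simp: algebra_simps)

lemma pev_map_uminus: "pev (map uminus xs) w = - pev xs w"
  by (induction xs) (auto simp: algebra_simps)

lemma pev_one: "pev xs 1 = of_int (sum_list xs)"
  by (induction xs) auto

lemma pev_eq_sum: "pev xs w = (\<Sum>n<length xs. of_int (xs ! n) * w ^ n)"
  by (induction xs) (auto simp: sum.lessThan_Suc_shift sum_distrib_left mult_ac simp del: sum.lessThan_Suc)

lemma pev_has_field_derivative: "(pev xs has_field_derivative pev (pdiff xs) w) (at w)"
proof (induction xs)
  case (Cons a as)
  have "((\<lambda>w. of_int a + w * pev as w) has_field_derivative 0 + (1 * pev as w + pev (pdiff as) w * w)) (at w)"
    by (intro DERIV_add DERIV_const DERIV_mult DERIV_ident Cons)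
  then show ?case by (simp add: pev_padd mult.commute)
qed simp

lemma deriv_pev: "deriv (pev xs) = pev (pdiff xs)"
  using pev_has_field_derivative by (auto intro: DERIV_imp_deriv)

lemma pev_holomorphic: "pev xs holomorphic_on S"
  using pev_has_field_derivative holomorphic_on_def field_differentiable_def
    field_differentiable_at_within by blast

lemma Re_pev_corr:
  assumes w: "cmod w = 1"
  shows "Re (pev (corr xs ys) w) = Re (cnj (pev xs w) * pev ys w)"
proof (induction xs ys rule: corr.induct)
  case (1 x xs y ys)
  let ?X = "pev xs w" and ?Y = "pev ys w"
  have "cnj (w * ?X) * (w * ?Y) = (w * cnj w) * (cnj ?X * ?Y)" by (simp add: mult_ac)
  also have "w * cnj w = 1" using w by (simp flip: complex_norm_square)
  finally have "Re (cnj (w * ?X) * (w * ?Y)) = Re (cnj ?X * ?Y)" by (simp only: mult_1_left)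
  moreover have "Re (cnj (of_int x + w * ?X) * (of_int y + w * ?Y)) =
     of_int (x * y) + of_int x * Re (w * ?Y) + of_int y * Re (w * ?X) + Re (cnj (w * ?X) * (w * ?Y))"
    by (simp add: algebra_simps)
  moreover have "Re (pev (corr (x # xs) (y # ys)) w) =
     of_int (x * y) + of_int x * Re (w * ?Y) + of_int y * Re (w * ?X) + Re (pev (corr xs ys) w)"
    by (simp add: pev_padd pev_map_mult algebra_simps)
  ultimately show ?case using 1 by simp
qed auto

lemma Re_pev_corr_self: "cmod w = 1 \<Longrightarrow> Re (pev (corr xs xs) w) = (cmod (pev xs w))\<^sup>2"
  by (subst Re_pev_corr) (simp_all add: cmod_power2, simp add: power2_eq_square)

lemma norm_pev_le:
  assumes "cmod w = 1" shows "cmod (pev xs w) \<le> of_int (sum_list (map abs xs))"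
proof (induction xs)
  case (Cons a as)
  have "cmod (pev (a # as) w) \<le> cmod (of_int a) + cmod (w * pev as w)"
    unfolding pev.simps by (rule norm_triangle_ineq)
  then show ?case using Cons assms by (simp add: norm_mult)
qed simp

text \<open>An approximate Fejer--Riesz factorisation: \<open>Re (pev cs w)\<close> exceeds \<open>|pev hs w|\<^sup>2\<close> on the
  unit circle, since the constant term of the difference dominates its other coefficients.\<close>

definition circle_positive_cert :: "int list \<Rightarrow> int list \<Rightarrow> bool" where
  "circle_positive_cert cs hs \<longleftrightarrow>
     (case padd cs (map uminus (corr hs hs)) of [] \<Rightarrow> False | d # ds \<Rightarrow> sum_list (map abs ds) < d)"

lemma circle_positive_cert:
  assumes cert: "circle_positive_cert cs hs" and w: "cmod w = 1"
  shows "0 < Re (pev cs w)"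
proof -
  obtain d ds where d: "padd cs (map uminus (corr hs hs)) = d # ds" "sum_list (map abs ds) < d"
    using cert by (auto simp: circle_positive_cert_def split: list.splits)
  have "\<bar>Re (w * pev ds w)\<bar> \<le> cmod (w * pev ds w)" by (rule abs_Re_le_cmod)
  also have "\<dots> \<le> of_int (sum_list (map abs ds))" using norm_pev_le[OF w] w by (simp add: norm_mult)
  also have "\<dots> < of_int d" using d(2) by (simp only: of_int_less_iff)
  finally have "0 < Re (pev (d # ds) w)" by (simp del: times_complex.simps add: abs_less_iff)
  moreover have "pev (d # ds) w = pev cs w - pev (corr hs hs) w"
    unfolding d(1)[symmetric] by (simp add: pev_padd pev_map_uminus)
  ultimately show ?thesis using Re_pev_corr_self[OF w, of hs] by (metis add_less_cancel_left diff_gt_0_iff_gt dual_order.strict_trans2 minus_complex.sel(1) zero_le_power2)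
qed

lemma Re_pos_on_cball:
  assumes h: "h holomorphic_on UNIV" and pos: "\<And>w. cmod w = 1 \<Longrightarrow> Re (h w) > 0" and w: "w \<in> cball 0 1"
  shows "Re (h w) > 0"
proof -
  have cont: "continuous_on S h" for S
    using holomorphic_on_imp_continuous_on[OF holomorphic_on_subset[OF h subset_UNIV]] .
  have "\<exists>y\<in>sphere 0 1. \<forall>z\<in>sphere 0 1. Re (h y) \<le> Re (h z)"
    by (rule continuous_attains_inf) (auto intro!: continuous_intros cont)
  then obtain y where y: "cmod y = 1" "\<And>z. cmod z = 1 \<Longrightarrow> Re (h y) \<le> Re (h z)" by auto
  have "Re (- h w) \<le> - Re (h y)"
  proof (rule maximum_real_frontier[of "\<lambda>w. - h w" "cball 0 1"])
    show "(\<lambda>w. - h w) holomorphic_on interior (cball 0 1)"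
      by (intro holomorphic_intros holomorphic_on_subset[OF h]) auto
  qed (use y w in \<open>auto intro!: continuous_intros cont\<close>)
  then show ?thesis using pos[OF y(1)] by simp
qed

section \<open>A rational upper bound for pi\<close>

lemma arctan_upper: "arctan x \<le> x - x ^ 3 / 3 + x ^ 5 / 5" if "0 \<le> x"
proof -
  have "0 - 0 ^ 3 / 3 + 0 ^ 5 / 5 - arctan 0 \<le> x - x ^ 3 / 3 + x ^ 5 / 5 - arctan x"
  proof (rule DERIV_nonneg_imp_nondecreasing[OF that])
    fix y :: real
    have "((\<lambda>x. x - x ^ 3 / 3 + x ^ 5 / 5 - arctan x) has_real_derivative 1 - y ^ 2 + y ^ 4 - inverse (1 + y\<^sup>2)) (at y)"
      by (auto intro!: derivative_eq_intros)
    moreover have "1 - y ^ 2 + y ^ 4 - inverse (1 + y\<^sup>2) = y ^ 6 / (1 + y\<^sup>2)"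
    proof -
      have "1 + y\<^sup>2 \<noteq> 0" by (metis add_pos_nonneg less_numeral_extra(1,3) zero_le_power2)
      then show ?thesis by (simp add: field_simps)
    qed
    ultimately show "\<exists>z. ((\<lambda>x. x - x ^ 3 / 3 + x ^ 5 / 5 - arctan x) has_real_derivative z) (at y) \<and> 0 \<le> z"
      by (intro exI conjI) (assumption, simp)
  qed
  then show ?thesis by simp
qed

lemma arctan_lower: "x - x ^ 3 / 3 \<le> arctan x" if "0 \<le> x"
proof -
  have "arctan 0 - (0 - 0 ^ 3 / 3) \<le> arctan x - (x - x ^ 3 / 3)"
  proof (rule DERIV_nonneg_imp_nondecreasing[OF that])
    fix y :: real
    have "((\<lambda>x. arctan x - (x - x ^ 3 / 3)) has_real_derivative inverse (1 + y\<^sup>2) - (1 - y ^ 2)) (at y)"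
      by (auto intro!: derivative_eq_intros)
    moreover have "inverse (1 + y\<^sup>2) - (1 - y ^ 2) = y ^ 4 / (1 + y\<^sup>2)"
    proof -
      have "1 + y\<^sup>2 \<noteq> 0" by (metis add_pos_nonneg less_numeral_extra(1,3) zero_le_power2)
      then show ?thesis by (simp add: field_simps)
    qed
    ultimately show "\<exists>z. ((\<lambda>x. arctan x - (x - x ^ 3 / 3)) has_real_derivative z) (at y) \<and> 0 \<le> z"
      by (intro exI conjI) (assumption, simp)
  qed
  then show ?thesis by simp
qed

lemma pi_less_22_7: "pi < 22 / 7"
proof -
  have "pi = 16 * arctan (1 / 5) - 4 * arctan (1 / 239)" using machin by simp
  also have "\<dots> \<le> 16 * (1 / 5 - (1 / 5) ^ 3 / 3 + (1 / 5) ^ 5 / 5) - 4 * (1 / 239 - (1 / 239) ^ 3 / 3)"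
    by (intro diff_mono mult_left_mono arctan_upper arctan_lower) auto
  also have "\<dots> < 22 / 7" by (simp add: power_divide)
  finally show ?thesis .
qed

text \<open>Both the boundary gradient and the square root of the area scale linearly, so only the
  proportions matter; the factor 100000 makes the coefficients integers.\<close>

definition extremal_coeffs :: "int list" where
  "extremal_coeffs = [0, 100000, 9926, -11793, -8765, -1619, 2355, 2580, 953, -586, -1056, -551, 213, 520,
     212, -214, -190, 110]"

text \<open>The squares of the listed numbers add up to 67013. This leaves 32987 of the constant
  term 100000 to dominate the other coefficients of the difference.\<close>

lemma Re_deriv_cert: "circle_positive_cert (pdiff extremal_coeffs)
    [239, 29, -61, -55, -8, 26, 28, 9, -10, -16, -9, 4, 11, 6, -5, -7, 4]"
  by code_simp

text \<open>The arguments of \<open>corr\<close> are \<open>f'\<close> and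
  \<open>f' + w f''\<close>, so on the circle the certified real part is
  \<open>|f'|^2 * Re (1 + w f'' / f')\<close>.\<close>

lemma convexity_cert: "circle_positive_cert
    (corr (pdiff extremal_coeffs) (padd (pdiff extremal_coeffs) (0 # pdiff (pdiff extremal_coeffs))))
    [49708, -20658, -63888, -26390, 38943, 62497, 27329, -27398, -53713, -34960, 8983, 43983, 42439, 176,
     -45189, -30818, 33858]"
  by code_simp

text \<open>In order: \<open>f 1\<close>, \<open>f' 1\<close>, \<open>Q' 1\<close>, and the area
  divided by \<open>pi\<close>.\<close>

lemma extremal_values:
  "sum_list extremal_coeffs = 92095"
  "sum_list (pdiff extremal_coeffs) = 67141"
  "sum_list (pdiff (corr extremal_coeffs extremal_coeffs)) = -5499387824"
  "(\<Sum>n\<le>17. int n * (extremal_coeffs ! n)\<^sup>2) = 11045559445"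
  by code_simp+

theorem large_torsion_gradient:
  "\<not> (\<forall>\<Omega> u. bounded_convex_domain \<Omega> \<and> torsion_function \<Omega> u \<longrightarrow>
        (\<forall>x\<in>\<Omega>. norm (grad u x) \<le> 0.357 * sqrt (measure lebesgue \<Omega>)))"
proof
  assume all: "\<forall>\<Omega> u. bounded_convex_domain \<Omega> \<and> torsion_function \<Omega> u \<longrightarrow>
        (\<forall>x\<in>\<Omega>. norm (grad u x) \<le> 0.357 * sqrt (measure lebesgue \<Omega>))"
  define f where "f = pev extremal_coeffs"
  define Q where "Q = pev (corr extremal_coeffs extremal_coeffs)"
  define \<Omega> where "\<Omega> = rv ` f ` ball 0 1"
  have f: "f holomorphic_on UNIV" and Q: "Q holomorphic_on UNIV"
    by (simp_all add: f_def Q_def pev_holomorphic)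
  have df: "deriv f = pev (pdiff extremal_coeffs)"
    "deriv (deriv f) = pev (pdiff (pdiff extremal_coeffs))"
    by (simp_all add: f_def deriv_pev)
  have pos: "Re (deriv f w) > 0" if "w \<in> cball 0 1" for w
    unfolding df by (rule Re_pos_on_cball[OF pev_holomorphic circle_positive_cert[OF Re_deriv_cert] that])
  have conv: "Re (cnj (deriv f w) * (deriv f w + w * deriv (deriv f) w)) > 0" if "cmod w = 1" for w
    using circle_positive_cert[OF convexity_cert that]
    unfolding Re_pev_corr[OF that] by (simp add: df(1) deriv_pev pev_padd del: times_complex.simps)
  have Qf: "Re (Q w) = (cmod (f w))\<^sup>2" if "cmod w = 1" for w
    unfolding Q_def f_def using that by (rule Re_pev_corr_self)
  note tors = conformal_torsion[OF f pos conv Q Qf, folded \<Omega>_def]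
  obtain u where u: "torsion_function \<Omega> u"
    "\<And>w. w \<in> ball 0 1 \<Longrightarrow> u (rv (f w)) = (Re (Q w) - (cmod (f w))\<^sup>2) / 4"
    using tors(2) by blast
  define A where "A = measure lebesgue \<Omega>"
  have "0 \<le> A" by (simp add: A_def)
  have "\<bar>Re (deriv Q 1) - 2 * Re (cnj (f 1) * deriv f 1)\<bar> / 4 \<le> (0.357 * sqrt A) * cmod (deriv f 1)"
    unfolding A_def using all tors(1) u(1)
    by (intro radial_derivative_le_gradient_bound[OF f Q u(1) _ u(2)]) (auto simp: \<Omega>_def)
  \<comment> \<open>The numerator is
    \<open>|Q' 1 - 2 * f 1 * f' 1| = 5499387824 + 2 * 92095 * 67141\<close>.\<close>
  then have le: "17866088614 / 4 \<le> 0.357 * sqrt A * 67141"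
    by (simp add: df f_def Q_def deriv_pev pev_one extremal_values)
  have "A \<le> pi * 11045559445"
  proof -
    have "length extremal_coeffs = 18" by (simp add: extremal_coeffs_def)
    then have f_sum: "f = (\<lambda>w. \<Sum>n\<le>17. complex_of_real (of_int (extremal_coeffs ! n)) * w ^ n)"
      by (simp add: f_def pev_eq_sum fun_eq_iff lessThan_Suc_atMost[of 17, simplified])
    have "inj_on f (ball 0 1)"
      by (rule Re_deriv_pos_imp_inj_on[OF f]) (use pos in auto)
    then have "A \<le> pi * (\<Sum>n\<le>17. real n * (of_int (extremal_coeffs ! n))\<^sup>2)"
      unfolding A_def \<Omega>_def f_sum
      by (intro measure_real_polynomial_image_le) (simp_all add: extremal_coeffs_def)
    also have "(\<Sum>n\<le>17. real n * (of_int (extremal_coeffs ! n))\<^sup>2) =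
        of_int (\<Sum>n\<le>17. int n * (extremal_coeffs ! n)\<^sup>2)"
      by simp
    also have "\<dots> = 11045559445" unfolding extremal_values by simp
    finally show ?thesis .
  qed
  \<comment> \<open>The boundary gradient is about 66524.5 and the square root of the area at most
    about 186281, a quotient of about 0.3571; rounding \<open>pi\<close> up to \<open>22 / 7\<close>
    still leaves it above 0.357.\<close>
  also have "\<dots> < 22 / 7 * 11045559445" using pi_less_22_7 by (intro mult_strict_right_mono) auto
  finally have "0.357\<^sup>2 * A * 67141\<^sup>2 < 0.357\<^sup>2 * (22 / 7 * 11045559445) * 67141\<^sup>2" by simp
  moreover have "(17866088614 / 4)\<^sup>2 \<le> (0.357 * sqrt A * 67141)\<^sup>2"
    by (rule power_mono[OF le]) simp
  moreover have "(0.357 * sqrt A * 67141)\<^sup>2 = 0.357\<^sup>2 * A * 67141\<^sup>2"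
    by (simp only: power_mult_distrib real_sqrt_pow2[OF \<open>0 \<le> A\<close>])
  ultimately show False by (simp add: power2_eq_square)
qed

theorem theorem1:
  shows "(\<exists>c::real. c < 1 / sqrt (2 * pi) \<and>
            (\<forall>\<Omega> u. bounded_convex_domain \<Omega> \<and> torsion_function \<Omega> u \<longrightarrow>
               (\<forall>x\<in>\<Omega>. norm (grad u x) \<le> c * sqrt (measure lebesgue \<Omega>))))
       \<and> \<not> (\<forall>\<Omega> u. bounded_convex_domain \<Omega> \<and> torsion_function \<Omega> u \<longrightarrow>
               (\<forall>x\<in>\<Omega>. norm (grad u x) \<le> 0.357 * sqrt (measure lebesgue \<Omega>)))"
proof (rule conjI[OF _ large_torsion_gradient], intro exI conjI allI impI ballI)
  show "0.975625 / sqrt (2 * pi) < 1 / sqrt (2 * pi)"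
    by (rule divide_strict_right_mono) simp_all
qed (use torsion_gradient_bound in blast)

end
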